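(* Let $K$ be a field of characteristic $0$, let $n\ge 2$, and let $f=\sum_{i_1,\dots,i_n\ge 0}a_{i_1,\dots,i_n}x_1^{i_1}\cdots x_n^{i_n}\in K[[x_1,\dots,x_n]]$ be D-finite over $K(x_1,\dots,x_n)$. For each $i\in\{1,\dots,n\}$ fix a non-zero operator $L_i\in K[x_1,\dots,x_n]\langle D_{x_i}\rangle$ with $L_i(f)=0$, of order $r_i$ and degree $d_i$, and put $r_f=\max_i r_i$, $d_f=\max_i d_i$. Let $\Delta(f)=\sum_{i\ge 0}a_{i,\dots,i}\,t^i\in K[[t]]$ be the complete diagonal (written in the variable $t=x_n$). Set $$D=n\Bigl(2+\sum_{i=1}^n d_i\Bigr),\qquad N'=(2D+1)^n\prod_{j=1}^n r_j,\qquad N=\frac{(2D+1)^n}{D}\prod_{j=1}^n r_j .$$ Then there exists a non-zero operator $\tilde P\in K[t]\langle D_t\rangle$ with $\tilde P(\Delta(f))=0$, $\deg(\tilde P)\le N'$ and $\operatorname{ord}(\tilde P)\le N$. Moreover, for every $\varepsilon>0$, $N'=O\bigl((2+\varepsilon)^n n^{2n} d_f^n r_f^n\bigr)$ and $N=O\bigl((2+\varepsilon)^n n^{2n-1} d_f^{n-1} r_f^n\bigr)$ when $n$, $d_f$, $r_f$ tend independently to infinity.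
   Context: A series $g\in K[[x_1,\dots,x_n]]$ is D-finite over $K(x_1,\dots,x_n)$ if the $K(x_1,\dots,x_n)$-vector space spanned in $K(x_1,\dots,x_n)\otimes_{K[x_1,\dots,x_n]}K[[x_1,\dots,x_n]]$ by all partial derivatives $D_{x_1}^{\alpha_1}\cdots D_{x_n}^{\alpha_n}(g)$, $\alpha\in\mathbb N^n$, is finite-dimensional; then for each $i$ there is a non-zero annihilating operator in $K[x_1,\dots,x_n]\langle D_{x_i}\rangle$. For an operator $L=\sum_{j=0}^{r}\ell_j D_{x_i}^j$ with polynomial coefficients and $\ell_r\ne0$, its order is $r$ and its degree is the maximum total degree of the $\ell_j$. Here $K[t]\langle D_t\rangle$ is the ring of linear differential operators in $D_t=d/dt$ with polynomial coefficients in $t$. *)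

theory Defs
  imports "HOL-Computational_Algebra.Computational_Algebra"
begin

text \<open>Multivariate formal power series in the variables x_0,...,x_(n-1) are represented by
their coefficient functions on exponent vectors (nat => nat); exponents of variables
with index >= n must carry zero coefficients.  Multivariate polynomials are such
coefficient functions with finite support.\<close>

type_synonym 'a mser = "(nat \<Rightarrow> nat) \<Rightarrow> 'a"

definition in_vars :: "nat \<Rightarrow> 'a::zero mser \<Rightarrow> bool" where
  "in_vars n f \<longleftrightarrow> (\<forall>\<alpha>. f \<alpha> \<noteq> 0 \<longrightarrow> (\<forall>k\<ge>n. \<alpha> k = 0))"

definition is_mpoly :: "nat \<Rightarrow> 'a::zero mser \<Rightarrow> bool" where
  "is_mpoly n p \<longleftrightarrow> in_vars n p \<and> finite {\<alpha>. p \<alpha> \<noteq> 0}"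

definition mpoly_mult :: "'a::comm_semiring_1 mser \<Rightarrow> 'a mser \<Rightarrow> 'a mser" where
  "mpoly_mult p f = (\<lambda>\<alpha>. \<Sum>\<beta>\<in>{\<beta>. p \<beta> \<noteq> 0 \<and> (\<forall>k. \<beta> k \<le> \<alpha> k)}. p \<beta> * f (\<lambda>k. \<alpha> k - \<beta> k))"

definition mderiv :: "nat \<Rightarrow> 'a::comm_semiring_1 mser \<Rightarrow> 'a mser" where
  "mderiv i f = (\<lambda>\<alpha>. of_nat (Suc (\<alpha> i)) * f (\<alpha>(i := Suc (\<alpha> i))))"

definition mderivs :: "nat \<Rightarrow> (nat \<Rightarrow> nat) \<Rightarrow> 'a::comm_semiring_1 mser \<Rightarrow> 'a mser" where
  "mderivs n a f = fold (\<lambda>k g. (mderiv k ^^ a k) g) [0..<n] f"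

text \<open>D-finiteness: the K(x)-span of all partial derivatives in K(x) (tensor) K[[x]] is
finite-dimensional, i.e. for some m any m+1 derivatives are K(x)-linearly dependent;
after clearing denominators (K[[x]] is a domain) this is linear dependence with
polynomial coefficients, not all zero.\<close>
definition D_finite :: "nat \<Rightarrow> 'a::field mser \<Rightarrow> bool" where
  "D_finite n f \<longleftrightarrow> (\<exists>m. \<forall>als :: (nat \<Rightarrow> nat) list. length als = Suc m \<longrightarrow>
     (\<exists>cs. length cs = Suc m \<and> (\<forall>c\<in>set cs. is_mpoly n c) \<and> (\<exists>c\<in>set cs. c \<noteq> (\<lambda>_. 0)) \<and>
        (\<forall>\<beta>. (\<Sum>j<Suc m. mpoly_mult (cs ! j) (mderivs n (als ! j) f) \<beta>) = 0)))"

text \<open>A differential operator  sum_{j<=r} L j * D_{x_i}^j  with polynomial coefficients;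
it has order r (leading coefficient L r nonzero, so the operator is nonzero).\<close>
definition is_mop :: "nat \<Rightarrow> (nat \<Rightarrow> 'a::zero mser) \<Rightarrow> nat \<Rightarrow> bool" where
  "is_mop n L r \<longleftrightarrow> (\<forall>j. is_mpoly n (L j)) \<and> L r \<noteq> (\<lambda>_. 0) \<and> (\<forall>j>r. L j = (\<lambda>_. 0))"

definition diffop_apply :: "nat \<Rightarrow> nat \<Rightarrow> (nat \<Rightarrow> 'a::comm_semiring_1 mser) \<Rightarrow> 'a mser \<Rightarrow> 'a mser" where
  "diffop_apply i r L f = (\<lambda>\<alpha>. \<Sum>j\<le>r. mpoly_mult (L j) ((mderiv i ^^ j) f) \<alpha>)"

definition mpoly_tdeg :: "nat \<Rightarrow> 'a::zero mser \<Rightarrow> nat" where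
  "mpoly_tdeg n p = Max (insert 0 {(\<Sum>k<n. \<alpha> k) | \<alpha>. p \<alpha> \<noteq> 0})"

definition mop_deg :: "nat \<Rightarrow> nat \<Rightarrow> (nat \<Rightarrow> 'a::zero mser) \<Rightarrow> nat" where
  "mop_deg n r L = Max ((\<lambda>j. mpoly_tdeg n (L j)) ` {..r})"

definition diagonal :: "nat \<Rightarrow> 'a::zero mser \<Rightarrow> 'a fps" where
  "diagonal n f = Abs_fps (\<lambda>i. f (\<lambda>k. if k < n then i else 0))"

definition Dval :: "nat \<Rightarrow> (nat \<Rightarrow> nat) \<Rightarrow> nat" where
  "Dval n d = n * (2 + (\<Sum>i<n. d i))"

definition Nprime :: "nat \<Rightarrow> (nat \<Rightarrow> nat) \<Rightarrow> (nat \<Rightarrow> nat) \<Rightarrow> nat" where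
  "Nprime n d r = (2 * Dval n d + 1) ^ n * (\<Prod>j<n. r j)"

definition Nbound :: "nat \<Rightarrow> (nat \<Rightarrow> nat) \<Rightarrow> (nat \<Rightarrow> nat) \<Rightarrow> real" where
  "Nbound n d r = real ((2 * Dval n d + 1) ^ n * (\<Prod>j<n. r j)) / real (Dval n d)"

definition maxof :: "nat \<Rightarrow> (nat \<Rightarrow> nat) \<Rightarrow> nat" where
  "maxof n d = Max (d ` {..<n})"

end

(* Lipshitz's argument.  Put x_l = s_l for l < n-1 and x_(n-1) = t / (s_0 ... s_(n-2)), so that the
   diagonal is the coefficient of (s_0 ... s_(n-2))^(-1) in F = f / (s_0 ... s_(n-2)).  Apply all
   monomials t^i D_t^j D_s^k with i <= N' and j, k_l <= N to F.  After multiplication by a fixed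
   power of the product of the leading coefficients of the L_i, everything lies in the span of
   x^beta D^gamma(f) with beta_l <= 2N' and gamma_l < r_l; there are more operator monomials than
   such generators, which yields an operator in t, D_t, D_s annihilating F.  If k has minimal sum
   among the exponents of D_s occurring in it, taking the coefficient of s^(-k-1) leaves only D_s^k and
   produces an operator in t and D_t that annihilates the diagonal.

   D_s and D_t would require Laurent series; instead each monomial is replaced by a
   coefficientwise multiplication (a polynomial in Euler operators) followed by a monomial shift. *)

theory Submission
  imports Defs "HOL-Library.Function_Algebras"
begin

section \<open>Multivariate series as a vector space\<close>

text \<open>The fixed power is \<open>n * M\<close>, with \<open>M\<close> the integer part of
  \<open>N' / D\<close>: the operator monomials have order at most \<open>n * M\<close>, and each
  factor lowers the order of a derivative not yet reduced by at least one while adding at most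
  \<open>\<delta>\<close>, the sum of the \<open>d_i\<close>, to every exponent. A further
  \<open>n * M\<close> comes from writing a polynomial in Euler operators as a combination of the
  \<open>x^\<kappa> D^\<kappa>\<close>, and \<open>2 * M + N'\<close> from the final shift, whose
  negative exponents are offset by multiplying with \<open>(x_0 ... x_(n-1))^(2 M)\<close>. Since
  \<open>n \<ge> 2\<close>, all of this adds up to at most \<open>M D + N' \<le> 2 N'\<close>; this
  is where \<open>D = n (2 + \<delta>)\<close> comes from. \<open>N'\<close> is then chosen so that
  the number \<open>(2 N' + 1)^n (r_0 ... r_(n-1))\<close> of generators stays below the number
  \<open>(N' + 1) (M + 1)^n\<close> of operator monomials.\<close>

definition mscale :: "'a::times \<Rightarrow> 'a mser \<Rightarrow> 'a mser" where
  "mscale c f = (\<lambda>\<alpha>. c * f \<alpha>)"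

interpretation mser: vector_space "mscale :: 'a::field \<Rightarrow> 'a mser \<Rightarrow> 'a mser"
  by unfold_locales (auto simp: mscale_def fun_eq_iff algebra_simps)

interpretation mser_pair: vector_space_pair
  "mscale :: 'a::field \<Rightarrow> 'a mser \<Rightarrow> 'a mser" "mscale :: 'a::field \<Rightarrow> 'a mser \<Rightarrow> 'a mser" ..

abbreviation mlinear :: "('a::field mser \<Rightarrow> 'a mser) \<Rightarrow> bool" where
  "mlinear \<equiv> Vector_Spaces.linear mscale mscale"

lemma sum_fun_apply: "(\<Sum>x\<in>A. F x) y = (\<Sum>x\<in>A. F x y)"
  by (induction A rule: infinite_finite_induct) auto

lemma mlinearI:
  fixes T :: "'a::field mser \<Rightarrow> 'a mser"
  assumes "\<And>g h \<alpha>. T (\<lambda>\<alpha>. g \<alpha> + h \<alpha>) \<alpha> = T g \<alpha> + T h \<alpha>"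
    and "\<And>c g \<alpha>. T (\<lambda>\<alpha>. c * g \<alpha>) \<alpha> = c * T g \<alpha>"
  shows "mlinear T"
  unfolding Vector_Spaces.linear_iff
  using assms by (auto simp: fun_eq_iff mscale_def plus_fun_def mser.vector_space_axioms)

lemma mlinear_span:
  assumes "mlinear T" "v \<in> mser.span X" "\<And>x. x \<in> X \<Longrightarrow> T x \<in> mser.span Y"
  shows "T v \<in> mser.span Y"
proof -
  have "T v \<in> mser.span (T ` X)"
    using assms(1,2) mser_pair.linear_span_image by blast
  moreover have "mser.span (T ` X) \<subseteq> mser.span Y"
    using assms(3) by (intro mser.span_minimal) auto
  ultimately show ?thesis by blast
qed

text \<open>The relation is wanted for an indexed family, whereas dependence is a property of sets.
  A repeated value \<open>G x = G y\<close> is therefore treated apart, with coefficients 1 and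
  -1.\<close>

lemma exists_linear_relation:
  fixes G :: "'i \<Rightarrow> 'a::field mser"
  assumes "finite I" "finite Y" "card Y < card I" "\<And>x. x \<in> I \<Longrightarrow> G x \<in> mser.span Y"
  shows "\<exists>c. (\<exists>x\<in>I. c x \<noteq> 0) \<and> (\<Sum>x\<in>I. mscale (c x) (G x)) = 0"
proof (cases "inj_on G I")
  case True
  have fin: "finite (G ` I)" using assms(1) by simp
  have "\<not> mser.independent (G ` I)"
  proof
    assume "mser.independent (G ` I)"
    hence "card (G ` I) \<le> card Y"
      using mser.independent_span_bound[of Y "G ` I"] assms by blast
    thus False using assms(3) card_image[OF True] by simp
  qed
  hence "\<exists>u. (\<exists>v\<in>G ` I. u v \<noteq> 0) \<and> (\<Sum>v\<in>G ` I. mscale (u v) v) = 0"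
    unfolding not_not mser.dependent_finite[OF fin] .
  then obtain u where u: "\<exists>v\<in>G ` I. u v \<noteq> 0" "(\<Sum>v\<in>G ` I. mscale (u v) v) = 0"
    by (elim exE conjE)
  have "(\<Sum>x\<in>I. mscale (u (G x)) (G x)) = 0"
    using u(2) sum.reindex[OF True, of "\<lambda>v. mscale (u v) v"] by (simp add: o_def)
  moreover have "\<exists>x\<in>I. u (G x) \<noteq> 0" using u(1) by blast
  ultimately show ?thesis by (intro exI[of _ "\<lambda>x. u (G x)"] conjI)
next
  case False
  then obtain x y where xy: "x \<in> I" "y \<in> I" "x \<noteq> y" "G x = G y"
    unfolding inj_on_def by blast
  let ?c = "\<lambda>z. if z = x then (1::'a) else if z = y then - 1 else 0"
  have "(\<Sum>z\<in>I. mscale (?c z) (G z)) = (\<Sum>z\<in>{x, y}. mscale (?c z) (G z))"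
    using xy(1,2) assms(1) by (intro sum.mono_neutral_right) auto
  also have "\<dots> = mscale 1 (G x) + mscale (- 1) (G y)"
    using xy(3) by simp
  also have "\<dots> = 0"
    unfolding xy(4) by (simp only: mser.scale_minus_left right_minus)
  finally have "(\<Sum>z\<in>I. mscale (?c z) (G z)) = 0" .
  moreover have "\<exists>z\<in>I. ?c z \<noteq> 0" using xy(1) by (intro bexI[of _ x]) simp
  ultimately show ?thesis by (intro exI[of _ ?c] conjI)
qed

section \<open>Shifts, products and derivatives\<close>

text \<open>Multiplication by the monomial \<open>x^\<beta>\<close>.\<close>

definition mshift :: "(nat \<Rightarrow> nat) \<Rightarrow> 'a::zero mser \<Rightarrow> 'a mser" where
  "mshift \<beta> g = (\<lambda>\<alpha>. if \<forall>l. \<beta> l \<le> \<alpha> l then g (\<lambda>l. \<alpha> l - \<beta> l) else 0)"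

definition box :: "nat \<Rightarrow> nat \<Rightarrow> (nat \<Rightarrow> nat) set" where
  "box n b = {\<beta>. \<forall>l. \<beta> l \<le> (if l < n then b else 0)}"

lemma card_fun_bounded:
  fixes B :: "nat \<Rightarrow> nat set"
  assumes "\<And>l. l < n \<Longrightarrow> finite (B l)"
  shows "finite {\<beta>. (\<forall>l<n. \<beta> l \<in> B l) \<and> (\<forall>l\<ge>n. \<beta> l = 0)}" (is "finite ?A")
    and "card {\<beta>. (\<forall>l<n. \<beta> l \<in> B l) \<and> (\<forall>l\<ge>n. \<beta> l = 0)} = (\<Prod>l<n. card (B l))"
proof -
  have bij: "bij_betw (\<lambda>\<beta>. restrict \<beta> {..<n}) ?A (PiE {..<n} B)"
    by (rule bij_betw_byWitness[where f' = "\<lambda>\<beta> l. if l < n then \<beta> l else 0"])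
       (force simp: fun_eq_iff PiE_def extensional_def restrict_def Pi_def)+
  have "finite (PiE {..<n} B)" using assms by (intro finite_PiE) auto
  thus "finite ?A" using bij_betw_finite[OF bij] by blast
  show "card ?A = (\<Prod>l<n. card (B l))"
    using bij_betw_same_card[OF bij] by (simp add: card_PiE)
qed

lemma box_eq: "box n b = {\<beta>. (\<forall>l<n. \<beta> l \<in> {..b}) \<and> (\<forall>l\<ge>n. \<beta> l = 0)}"
  unfolding box_def by (intro Collect_cong) (auto simp: not_less split: if_splits)

lemma finite_box: "finite (box n b)"
  unfolding box_eq by (rule card_fun_bounded) auto

lemma card_box: "card (box n b) = Suc b ^ n"
  unfolding box_eq by (subst card_fun_bounded) auto

lemma box_add: "\<beta> \<in> box n b \<Longrightarrow> \<gamma> \<in> box n c \<Longrightarrow> (\<lambda>l. \<beta> l + \<gamma> l) \<in> box n (b + c)"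
  by (auto simp: box_eq add_mono)

lemma box_mono: "b \<le> c \<Longrightarrow> box n b \<subseteq> box n c"
  by (auto simp: box_eq intro: order_trans)

lemma mlinear_mshift: "mlinear (mshift \<beta>)"
  by (rule mlinearI) (auto simp: mshift_def)

lemma mshift_mshift: "mshift \<beta> (mshift \<gamma> g) = mshift (\<lambda>l. \<beta> l + \<gamma> l) g"
proof
  fix \<alpha>
  have "(\<forall>l. \<beta> l + \<gamma> l \<le> \<alpha> l) \<longleftrightarrow> (\<forall>l. \<beta> l \<le> \<alpha> l) \<and> (\<forall>l. \<gamma> l \<le> \<alpha> l - \<beta> l)"
    by (metis add_leD1 add_le_cancel_left le_add_diff_inverse)
  thus "mshift \<beta> (mshift \<gamma> g) \<alpha> = mshift (\<lambda>l. \<beta> l + \<gamma> l) g \<alpha>"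
    by (auto simp: mshift_def)
qed

definition supp_box :: "nat \<Rightarrow> nat \<Rightarrow> 'a::zero mser \<Rightarrow> bool" where
  "supp_box n b p \<longleftrightarrow> (\<forall>\<beta>. p \<beta> \<noteq> 0 \<longrightarrow> \<beta> \<in> box n b)"

text \<open>Trading the index set, which depends on \<open>\<alpha>\<close>, for a fixed box turns
  the product into a finite linear combination of shifts, to which linearity and span arguments
  apply.\<close>

lemma mpoly_mult_eq:
  assumes "supp_box n b p"
  shows "mpoly_mult p g = (\<Sum>\<beta>\<in>box n b. mscale (p \<beta>) (mshift \<beta> g))"
proof
  fix \<alpha>
  have "mpoly_mult p g \<alpha> = (\<Sum>\<beta>\<in>{\<beta>. p \<beta> \<noteq> 0 \<and> (\<forall>k. \<beta> k \<le> \<alpha> k)}. p \<beta> * mshift \<beta> g \<alpha>)"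
    unfolding mpoly_mult_def by (intro sum.cong) (auto simp: mshift_def)
  also have "\<dots> = (\<Sum>\<beta>\<in>box n b. p \<beta> * mshift \<beta> g \<alpha>)"
    using assms by (intro sum.mono_neutral_left finite_box) (auto simp: supp_box_def mshift_def)
  finally show "mpoly_mult p g \<alpha> = (\<Sum>\<beta>\<in>box n b. mscale (p \<beta>) (mshift \<beta> g)) \<alpha>"
    by (simp add: sum_fun_apply mscale_def)
qed

lemma mlinear_mpoly_mult:
  assumes "supp_box n b p"
  shows "mlinear (mpoly_mult p)"
  unfolding mpoly_mult_eq[OF assms] Vector_Spaces.linear_iff
proof (intro conjI allI)
  fix g h :: "'a mser" and c
  show "(\<Sum>\<beta>\<in>box n b. mscale (p \<beta>) (mshift \<beta> (g + h))) =
    (\<Sum>\<beta>\<in>box n b. mscale (p \<beta>) (mshift \<beta> g)) + (\<Sum>\<beta>\<in>box n b. mscale (p \<beta>) (mshift \<beta> h))"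
    by (simp only: mser_pair.linear_add[OF mlinear_mshift] mser.scale_right_distrib sum.distrib)
  show "(\<Sum>\<beta>\<in>box n b. mscale (p \<beta>) (mshift \<beta> (mscale c g))) =
    mscale c (\<Sum>\<beta>\<in>box n b. mscale (p \<beta>) (mshift \<beta> g))"
    by (simp only: mser_pair.linear_scale[OF mlinear_mshift] mser.scale_sum_right mser.scale_left_commute)
qed (rule mser.vector_space_axioms)+

text \<open>These are maps linear over the polynomial ring: commuting with monomial shifts already
  entails commuting with multiplication by any polynomial.\<close>

definition msequi :: "('a::field mser \<Rightarrow> 'a mser) \<Rightarrow> bool" where
  "msequi T \<longleftrightarrow> mlinear T \<and> (\<forall>\<beta> g. T (mshift \<beta> g) = mshift \<beta> (T g))"

lemma msequi_mpoly_mult: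
  assumes "supp_box n b p"
  shows "msequi (mpoly_mult p)"
  unfolding msequi_def
proof (intro conjI allI)
  show "mlinear (mpoly_mult p)" by (rule mlinear_mpoly_mult[OF assms])
  fix \<beta> g
  have "mshift \<beta> (mpoly_mult p g) = (\<Sum>\<gamma>\<in>box n b. mscale (p \<gamma>) (mshift \<beta> (mshift \<gamma> g)))"
    unfolding mpoly_mult_eq[OF assms] mser_pair.linear_sum[OF mlinear_mshift]
      mser_pair.linear_scale[OF mlinear_mshift] ..
  also have "\<dots> = mpoly_mult p (mshift \<beta> g)"
    unfolding mpoly_mult_eq[OF assms] mshift_mshift by (simp only: add.commute)
  finally show "mpoly_mult p (mshift \<beta> g) = mshift \<beta> (mpoly_mult p g)" ..
qed

lemma msequi_comp:
  assumes "msequi S" "msequi T"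
  shows "msequi (S \<circ> T)"
  using assms Vector_Spaces.linear_compose[of mscale mscale T mscale S] by (simp add: msequi_def)

lemma msequi_id: "msequi id"
  using mser.linear_id by (simp add: msequi_def)

lemma msequi_commute:
  assumes "supp_box n b p" "msequi T"
  shows "T (mpoly_mult p g) = mpoly_mult p (T g)"
proof -
  have lin: "mlinear T" and eq: "T (mshift \<beta> h) = mshift \<beta> (T h)" for \<beta> h
    using assms(2) by (auto simp: msequi_def)
  show ?thesis
    unfolding mpoly_mult_eq[OF assms(1)] mser_pair.linear_sum[OF lin]
      mser_pair.linear_scale[OF lin] eq ..
qed

lemma msequi_funpow: "msequi T \<Longrightarrow> msequi (T ^^ q)"
  by (induction q) (simp_all add: msequi_id msequi_comp)

lemma mlinear_mderiv: "mlinear (mderiv l)"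
  by (rule mlinearI) (auto simp: mderiv_def algebra_simps)

text \<open>The Leibniz rule for \<open>x^\<beta> g\<close>. If \<open>\<beta> l = 0\<close>, the
  truncated exponent is harmless because its coefficient is 0.\<close>

lemma mderiv_mshift:
  fixes g :: "'a::field mser"
  shows "mderiv l (mshift \<beta> g) =
    mscale (of_nat (\<beta> l)) (mshift (\<beta>(l := \<beta> l - 1)) g) + mshift \<beta> (mderiv l g)"
proof
  fix \<alpha>
  \<comment> \<open>In case (b) the exponent \<open>\<alpha>\<close> misses the shifted support by
    one in direction \<open>l\<close>, so only the derivative of the monomial contributes.\<close>
  consider (a) "\<forall>k. \<beta> k \<le> \<alpha> k" | (b) "\<forall>k. k \<noteq> l \<longrightarrow> \<beta> k \<le> \<alpha> k" "\<beta> l = Suc (\<alpha> l)"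
    | (c) "\<not> (\<forall>k. \<beta> k \<le> (\<alpha>(l := Suc (\<alpha> l))) k)"
    by (metis fun_upd_apply le_SucE)
  thus "mderiv l (mshift \<beta> g) \<alpha> =
    (mscale (of_nat (\<beta> l)) (mshift (\<beta>(l := \<beta> l - 1)) g) + mshift \<beta> (mderiv l g)) \<alpha>"
  proof cases
    case a
    have 1: "\<forall>k. \<beta> k \<le> (\<alpha>(l := Suc (\<alpha> l))) k" using a by (auto simp: le_SucI)
    have 2: "\<forall>k. (\<beta>(l := \<beta> l - 1)) k \<le> \<alpha> k" using a by (simp add: le_diff_conv le_SucI)
    define h where "h = (\<lambda>k. \<alpha> k - \<beta> k)(l := Suc (\<alpha> l - \<beta> l))"
    have 3: "(\<lambda>k. (\<alpha>(l := Suc (\<alpha> l))) k - \<beta> k) = h"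
      using a by (auto simp: h_def fun_eq_iff Suc_diff_le)
    have 4: "\<beta> l \<noteq> 0 \<Longrightarrow> (\<lambda>k. \<alpha> k - (\<beta>(l := \<beta> l - 1)) k) = h"
      using spec[OF a, of l] by (auto simp: h_def fun_eq_iff)
    have 5: "of_nat (Suc (\<alpha> l)) = (of_nat (\<beta> l) + of_nat (Suc (\<alpha> l - \<beta> l)) :: 'a)"
      using spec[OF a, of l] by (metis Suc_diff_le le_SucI le_add_diff_inverse of_nat_add)
    show ?thesis
      unfolding plus_fun_def mderiv_def mshift_def mscale_def if_P[OF 1] if_P[OF 2] if_P[OF a] 3 5
      using 4 by (cases "\<beta> l = 0") (auto simp: h_def algebra_simps)
  next
    case b
    have 1: "\<forall>k. \<beta> k \<le> (\<alpha>(l := Suc (\<alpha> l))) k" using b by auto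
    have 2: "\<forall>k. (\<beta>(l := \<beta> l - 1)) k \<le> \<alpha> k" using b by auto
    have 3: "\<not> (\<forall>k. \<beta> k \<le> \<alpha> k)" using b by (metis Suc_n_not_le_n)
    have 4: "(\<lambda>k. \<alpha> k - (\<beta>(l := \<beta> l - 1)) k) = (\<lambda>k. (\<alpha>(l := Suc (\<alpha> l))) k - \<beta> k)"
      using b by auto
    show ?thesis
      unfolding plus_fun_def mderiv_def mshift_def mscale_def if_P[OF 1] if_P[OF 2] if_not_P[OF 3] 4
      using b by simp
  next
    case c
    obtain k where k: "\<not> \<beta> k \<le> (\<alpha>(l := Suc (\<alpha> l))) k" using c by blast
    hence "\<not> \<beta> k \<le> \<alpha> k" by (cases "k = l") auto
    hence 3: "\<not> (\<forall>k. \<beta> k \<le> \<alpha> k)" by blast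
    have "\<not> (\<beta>(l := \<beta> l - 1)) k \<le> \<alpha> k" using k by (cases "k = l") auto
    hence 2: "\<not> (\<forall>k. (\<beta>(l := \<beta> l - 1)) k \<le> \<alpha> k)" by blast
    show ?thesis
      unfolding plus_fun_def mderiv_def mshift_def mscale_def if_not_P[OF c] if_not_P[OF 2] if_not_P[OF 3]
      by simp
  qed
qed

text \<open>Closed form of \<open>D^\<kappa> f\<close>: the factor
  \<open>(\<alpha> l + 1) ... (\<alpha> l + \<kappa> l)\<close> collects what
  \<open>\<kappa> l\<close> derivatives in \<open>x_l\<close> bring down. In this form the order of
  differentiation never matters.\<close>

definition mdd :: "nat \<Rightarrow> (nat \<Rightarrow> nat) \<Rightarrow> 'a::comm_semiring_1 mser \<Rightarrow> 'a mser" where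
  "mdd n \<kappa> f = (\<lambda>\<alpha>. (\<Prod>l<n. pochhammer (of_nat (Suc (\<alpha> l))) (\<kappa> l)) * f (\<lambda>l. \<alpha> l + \<kappa> l))"

lemma mdd_zero: "mdd n (\<lambda>_. 0) f = f"
  by (simp add: mdd_def)

lemma mderiv_mdd:
  fixes f :: "'a::field mser"
  assumes "l < n"
  shows "mderiv l (mdd n \<kappa> f) = mdd n (\<kappa>(l := Suc (\<kappa> l))) f"
proof
  fix \<alpha>
  have arg: "(\<lambda>k. (\<alpha>(l := Suc (\<alpha> l))) k + \<kappa> k) = (\<lambda>k. \<alpha> k + (\<kappa>(l := Suc (\<kappa> l))) k)"
    by auto
  have "(of_nat (Suc (\<alpha> l)) :: 'a) *
      (\<Prod>k<n. pochhammer (of_nat (Suc ((\<alpha>(l := Suc (\<alpha> l))) k))) (\<kappa> k))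
    = of_nat (Suc (\<alpha> l)) * pochhammer (of_nat (Suc (Suc (\<alpha> l)))) (\<kappa> l) *
      (\<Prod>k\<in>{..<n}-{l}. pochhammer (of_nat (Suc (\<alpha> k))) (\<kappa> k))"
    using assms by (subst prod.remove[of _ l]) (auto simp: mult.assoc intro!: prod.cong)
  also have "of_nat (Suc (\<alpha> l)) * pochhammer (of_nat (Suc (Suc (\<alpha> l)))) (\<kappa> l) =
      (pochhammer (of_nat (Suc (\<alpha> l))) (Suc (\<kappa> l)) :: 'a)"
    by (simp add: pochhammer_rec add.commute)
  also have "\<dots> * (\<Prod>k\<in>{..<n}-{l}. pochhammer (of_nat (Suc (\<alpha> k))) (\<kappa> k)) =
      (\<Prod>k<n. pochhammer (of_nat (Suc (\<alpha> k))) ((\<kappa>(l := Suc (\<kappa> l))) k))"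
    using assms by (subst (2) prod.remove[of _ l]) (auto intro!: prod.cong)
  finally show "mderiv l (mdd n \<kappa> f) \<alpha> = mdd n (\<kappa>(l := Suc (\<kappa> l))) f \<alpha>"
    unfolding mderiv_def mdd_def arg by (simp only: mult.assoc[symmetric])
qed

lemma mderiv_funpow_mdd:
  fixes f :: "'a::field mser"
  assumes "i < n"
  shows "(mderiv i ^^ j) f = mdd n ((\<lambda>_. 0)(i := j)) f"
proof (induction j)
  case 0
  have "(\<lambda>_. 0)(i := 0) = (\<lambda>_. 0 :: nat)" by auto
  thus ?case by (simp add: mdd_zero)
next
  case (Suc j)
  show ?case
    by (simp only: funpow.simps o_apply Suc.IH mderiv_mdd[OF assms] fun_upd_same fun_upd_upd)
qed

section \<open>Cancellation\<close>

text \<open>Lexicographic order on all sequences is not well-founded. On finitely many coordinates a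
  least element is found by minimising one coordinate after another.\<close>

lemma exists_lexmin:
  fixes S :: "(nat \<Rightarrow> nat) set"
  assumes "S \<noteq> {}"
  shows "\<exists>\<alpha>0\<in>S. \<forall>\<alpha>\<in>S. \<forall>k<m. (\<forall>j<k. \<alpha> j = \<alpha>0 j) \<longrightarrow> \<alpha>0 k \<le> \<alpha> k"
proof (induction m)
  case 0
  show ?case using assms by auto
next
  case (Suc m)
  then obtain a where a: "a \<in> S"
    "\<And>\<alpha> k. \<alpha> \<in> S \<Longrightarrow> k < m \<Longrightarrow> (\<And>j. j < k \<Longrightarrow> \<alpha> j = a j) \<Longrightarrow> a k \<le> \<alpha> k" by blast
  define S' where "S' = {\<alpha>\<in>S. \<forall>j<m. \<alpha> j = a j}"
  have "a \<in> S'" using a by (auto simp: S'_def)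
  then obtain b where b: "b \<in> S'" "\<And>\<alpha>. \<alpha> \<in> S' \<Longrightarrow> b m \<le> \<alpha> m"
    using ex_has_least_nat[of "\<lambda>\<alpha>. \<alpha> \<in> S'" a "\<lambda>\<alpha>. \<alpha> m"] by blast
  have "b k \<le> \<alpha> k" if "\<alpha> \<in> S" "k < Suc m" "\<forall>j<k. \<alpha> j = b j" for \<alpha> k
  proof (cases "k = m")
    case True
    thus ?thesis using that b by (auto simp: S'_def)
  next
    case False
    hence "k < m" using that by simp
    thus ?thesis using a(2)[of \<alpha> k] that b(1) by (auto simp: S'_def)
  qed
  moreover have "b \<in> S" using b(1) by (simp add: S'_def)
  ultimately show ?case by blast
qed

text \<open>The lexicographically least exponents \<open>c\<close> of \<open>p\<close> and
  \<open>a\<close> of \<open>g\<close> add up to an exponent that no other pair reaches, so the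
  product has coefficient \<open>p c * g a\<close> there.\<close>

lemma mpoly_mult_cancel:
  fixes g :: "'a::field mser"
  assumes p: "supp_box n b p" "p \<noteq> 0" and g: "in_vars n g" and 0: "mpoly_mult p g = 0"
  shows "g = 0"
proof (rule ccontr)
  assume "g \<noteq> 0"
  hence "{\<alpha>. g \<alpha> \<noteq> 0} \<noteq> {}" by (auto simp: fun_eq_iff)
  from exists_lexmin[OF this, of n] obtain a where a: "g a \<noteq> 0"
    "\<And>\<alpha> k. g \<alpha> \<noteq> 0 \<Longrightarrow> k < n \<Longrightarrow> (\<And>j. j < k \<Longrightarrow> \<alpha> j = a j) \<Longrightarrow> a k \<le> \<alpha> k" by blast
  have "{\<alpha>. p \<alpha> \<noteq> 0} \<noteq> {}" using p(2) by (auto simp: fun_eq_iff)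
  from exists_lexmin[OF this, of n] obtain c where c: "p c \<noteq> 0"
    "\<And>\<alpha> k. p \<alpha> \<noteq> 0 \<Longrightarrow> k < n \<Longrightarrow> (\<And>j. j < k \<Longrightarrow> \<alpha> j = c j) \<Longrightarrow> c k \<le> \<alpha> k" by blast
  define \<alpha> where "\<alpha> = (\<lambda>l. c l + a l)"
  have *: "\<beta> = c" if "p \<beta> \<noteq> 0" "mshift \<beta> g \<alpha> \<noteq> 0" for \<beta>
  proof -
    have le: "\<beta> l \<le> \<alpha> l" for l using that(2) by (auto simp: mshift_def split: if_splits)
    have g': "g (\<lambda>l. \<alpha> l - \<beta> l) \<noteq> 0" using that(2) by (auto simp: mshift_def split: if_splits)
    have "k < n \<Longrightarrow> \<beta> k = c k" for k
    proof (induction k rule: less_induct)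
      case (less k)
      have eq: "\<beta> j = c j" if "j < k" for j using less that by simp
      have "c k \<le> \<beta> k" using c(2)[OF \<open>p \<beta> \<noteq> 0\<close> less.prems] eq by blast
      moreover have "a k \<le> \<alpha> k - \<beta> k"
        using a(2)[OF g' less.prems] eq by (auto simp: \<alpha>_def)
      ultimately show ?case using le[of k] by (auto simp: \<alpha>_def)
    qed
    moreover have "k \<ge> n \<Longrightarrow> \<beta> k = c k" for k
      using that(1) c(1) p(1) unfolding supp_box_def box_def
      by simp (metis le_zero_eq not_le)
    ultimately show ?thesis by (metis ext not_le)
  qed
  have c_box: "c \<in> box n b" using c(1) p(1) by (auto simp: supp_box_def)
  have "0 = (\<Sum>\<beta>\<in>box n b. p \<beta> * mshift \<beta> g \<alpha>)"
    using fun_cong[OF 0, of \<alpha>] by (simp add: mpoly_mult_eq[OF p(1)] sum_fun_apply mscale_def)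
  also have "\<dots> = (\<Sum>\<beta>\<in>{c}. p \<beta> * mshift \<beta> g \<alpha>)"
    using * c_box by (intro sum.mono_neutral_right finite_box) auto
  also have "\<dots> = p c * g a" by (auto simp: mshift_def \<alpha>_def)
  finally show False using a(1) c(1) by simp
qed

lemma in_vars_mshift:
  assumes "\<beta> \<in> box n b" "in_vars n g"
  shows "in_vars n (mshift \<beta> g)"
  unfolding in_vars_def
proof (intro allI impI)
  fix \<alpha> k assume *: "mshift \<beta> g \<alpha> \<noteq> 0" "n \<le> k"
  hence "g (\<lambda>l. \<alpha> l - \<beta> l) \<noteq> 0" by (auto simp: mshift_def split: if_splits)
  hence "\<alpha> k - \<beta> k = 0" using assms(2) *(2) by (auto simp: in_vars_def)
  moreover have "\<beta> k = 0" using assms(1) *(2) by (auto simp: box_eq)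
  ultimately show "\<alpha> k = 0" by simp
qed

lemma in_vars_sum:
  fixes G :: "'i \<Rightarrow> 'a::field mser"
  assumes "\<And>x. x \<in> A \<Longrightarrow> in_vars n (G x)"
  shows "in_vars n (\<Sum>x\<in>A. mscale (c x) (G x))"
  unfolding in_vars_def
proof (intro allI impI)
  fix \<alpha> k assume *: "(\<Sum>x\<in>A. mscale (c x) (G x)) \<alpha> \<noteq> 0" "n \<le> k"
  then obtain x where "x \<in> A" "mscale (c x) (G x) \<alpha> \<noteq> 0"
    unfolding sum_fun_apply by (meson sum.not_neutral_contains_not_neutral)
  thus "\<alpha> k = 0" using assms *(2) by (auto simp: in_vars_def mscale_def)
qed

lemma in_vars_mpoly_mult:
  fixes g :: "'a::field mser"
  assumes "supp_box n b p" "in_vars n g"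
  shows "in_vars n (mpoly_mult p g)"
  unfolding mpoly_mult_eq[OF assms(1)] using assms(2) by (intro in_vars_sum in_vars_mshift)

section \<open>Spans of shifted derivatives\<close>

definition gens :: "nat \<Rightarrow> nat \<Rightarrow> (nat \<Rightarrow> nat) set \<Rightarrow> 'a::field mser \<Rightarrow> 'a mser set" where
  "gens n b K f = {mshift \<beta> (mdd n \<kappa> f) | \<beta> \<kappa>. \<beta> \<in> box n b \<and> \<kappa> \<in> K}"

definition ord_le :: "nat \<Rightarrow> nat \<Rightarrow> (nat \<Rightarrow> nat) set" where
  "ord_le n q = {\<kappa>. (\<Sum>l<n. \<kappa> l) \<le> q \<and> (\<forall>l\<ge>n. \<kappa> l = 0)}"

lemma ord_le_upd:
  assumes "\<kappa> \<in> ord_le n q" "l < n"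
  shows "\<kappa>(l := Suc (\<kappa> l)) \<in> ord_le n (Suc q)"
proof -
  have "(\<Sum>k<n. (\<kappa>(l := Suc (\<kappa> l))) k) = Suc (\<kappa> l) + (\<Sum>k\<in>{..<n} - {l}. \<kappa> k)"
    using assms(2) by (subst sum.remove[of _ l]) auto
  also have "\<dots> = Suc (\<Sum>k<n. \<kappa> k)"
    using assms(2) by (subst (2) sum.remove[of _ l]) auto
  finally show ?thesis using assms by (auto simp: ord_le_def)
qed

lemma ord_le_mono: "q \<le> q' \<Longrightarrow> ord_le n q \<subseteq> ord_le n q'"
  by (auto simp: ord_le_def)

lemma box_decr:
  assumes "\<beta> \<in> box n b"
  shows "\<beta>(l := \<beta> l - 1) \<in> box n b"
proof -
  have "(\<beta>(l := \<beta> l - 1)) k \<le> \<beta> k" for k by simp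
  thus ?thesis using assms unfolding box_def by (blast intro: order_trans)
qed

lemma ord_le_box: "\<kappa> \<in> ord_le n q \<Longrightarrow> \<kappa> \<in> box n q"
  unfolding ord_le_def box_eq
  by (auto intro: order_trans[OF member_le_sum])

lemma zero_box: "(\<lambda>_. 0) \<in> box n b"
  by (simp add: box_def)

lemma mshift_zero: "mshift (\<lambda>_. 0) g = g"
  by (simp add: mshift_def)

lemma mdd_in_span: "\<kappa> \<in> K \<Longrightarrow> mdd n \<kappa> f \<in> mser.span (gens n b K f)"
  using zero_box[of n b] unfolding gens_def
  by (intro mser.span_base CollectI exI[of _ "\<lambda>_. 0"] exI[of _ \<kappa>]) (simp add: mshift_zero)

lemma gens_mono: "b \<le> c \<Longrightarrow> K \<subseteq> K' \<Longrightarrow> gens n b K f \<subseteq> gens n c K' f"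
  unfolding gens_def using box_mono[of b c n] by blast

lemma span_gens_mono:
  "g \<in> mser.span (gens n b K f) \<Longrightarrow> b \<le> c \<Longrightarrow> K \<subseteq> K' \<Longrightarrow> g \<in> mser.span (gens n c K' f)"
  using mser.span_mono[OF gens_mono[of b c K K' n f]] by blast

lemma finite_gens: "finite K \<Longrightarrow> finite (gens n b K f)"
  and card_gens: "finite K \<Longrightarrow> card (gens n b K f) \<le> Suc b ^ n * card K"
proof -
  assume K: "finite K"
  have eq: "gens n b K f = (\<lambda>(\<beta>, \<kappa>). mshift \<beta> (mdd n \<kappa> f)) ` (box n b \<times> K)"
    unfolding gens_def by force
  have fin: "finite (box n b \<times> K)" using K finite_box by blast
  show "finite (gens n b K f)" unfolding eq using fin by blast
  show "card (gens n b K f) \<le> Suc b ^ n * card K"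
    unfolding eq using card_image_le[OF fin] by (simp add: card_cartesian_product card_box)
qed

lemma span_gens_mshift:
  assumes "\<beta> \<in> box n c" "g \<in> mser.span (gens n b K f)"
  shows "mshift \<beta> g \<in> mser.span (gens n (b + c) K f)"
proof (rule mlinear_span[OF mlinear_mshift assms(2)])
  fix x assume "x \<in> gens n b K f"
  then obtain \<gamma> \<kappa> where x: "x = mshift \<gamma> (mdd n \<kappa> f)" "\<gamma> \<in> box n b" "\<kappa> \<in> K"
    unfolding gens_def by blast
  have "(\<lambda>l. \<beta> l + \<gamma> l) \<in> box n (b + c)"
    using box_add[OF assms(1) x(2)] by (simp add: add.commute)
  thus "mshift \<beta> x \<in> mser.span (gens n (b + c) K f)"
    unfolding x(1) mshift_mshift gens_def using x(3) by (intro mser.span_base) blast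
qed

lemma span_gens_mpoly_mult:
  assumes "supp_box n c p" "g \<in> mser.span (gens n b K f)"
  shows "mpoly_mult p g \<in> mser.span (gens n (b + c) K f)"
  unfolding mpoly_mult_eq[OF assms(1)]
  by (intro mser.span_sum mser.span_scale span_gens_mshift[OF _ assms(2)])

text \<open>By the Leibniz rule a derivative raises the order by one, but the monomial exponents can
  only fall.\<close>

lemma span_gens_mderiv:
  assumes "l < n" "g \<in> mser.span (gens n b (ord_le n q) f)"
  shows "mderiv l g \<in> mser.span (gens n b (ord_le n (Suc q)) f)"
proof (rule mlinear_span[OF mlinear_mderiv assms(2)])
  fix x assume "x \<in> gens n b (ord_le n q) f"
  then obtain \<gamma> \<kappa> where x: "x = mshift \<gamma> (mdd n \<kappa> f)" "\<gamma> \<in> box n b" "\<kappa> \<in> ord_le n q"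
    unfolding gens_def by blast
  have "\<gamma>(l := \<gamma> l - 1) \<in> box n b" by (rule box_decr[OF x(2)])
  moreover have "\<kappa> \<in> ord_le n (Suc q)" using x(3) by (auto simp: ord_le_def)
  ultimately have "mshift (\<gamma>(l := \<gamma> l - 1)) (mdd n \<kappa> f) \<in> mser.span (gens n b (ord_le n (Suc q)) f)"
    unfolding gens_def by (intro mser.span_base) blast
  moreover have "mshift \<gamma> (mderiv l (mdd n \<kappa> f)) \<in> mser.span (gens n b (ord_le n (Suc q)) f)"
    unfolding mderiv_mdd[OF assms(1)] gens_def
    using x(2) ord_le_upd[OF x(3) assms(1)] by (intro mser.span_base) blast
  ultimately show "mderiv l x \<in> mser.span (gens n b (ord_le n (Suc q)) f)"
    unfolding x(1) mderiv_mshift by (intro mser.span_add mser.span_scale)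
qed

text \<open>What remains are the terms in which \<open>D_l\<close> hits a monomial of
  \<open>p\<close>; they contain no new derivative of \<open>f\<close>.\<close>

lemma mpoly_mult_mderiv_commutator:
  assumes "supp_box n c p" "\<kappa> \<in> K"
  shows "mderiv l (mpoly_mult p (mdd n \<kappa> f)) - mpoly_mult p (mderiv l (mdd n \<kappa> f))
    \<in> mser.span (gens n c K f)"
proof -
  define g where "g = mdd n \<kappa> f"
  have "mderiv l (mpoly_mult p g) - mpoly_mult p (mderiv l g) =
    (\<Sum>\<beta>\<in>box n c. mscale (p \<beta>) (mscale (of_nat (\<beta> l)) (mshift (\<beta>(l := \<beta> l - 1)) g)))"
    unfolding mpoly_mult_eq[OF assms(1)] mser_pair.linear_sum[OF mlinear_mderiv]
      mser_pair.linear_scale[OF mlinear_mderiv] mderiv_mshift mser.scale_right_distrib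
      sum.distrib by simp
  moreover have "mshift (\<beta>(l := \<beta> l - 1)) g \<in> mser.span (gens n c K f)" if "\<beta> \<in> box n c" for \<beta>
  proof -
    have "\<beta>(l := \<beta> l - 1) \<in> box n c" by (rule box_decr[OF that])
    thus ?thesis unfolding g_def gens_def using assms(2) by (intro mser.span_base) blast
  qed
  ultimately show ?thesis
    unfolding g_def[symmetric] by (simp add: mser.span_sum mser.span_scale)
qed

section \<open>Multiplication by products of polynomials\<close>

primrec mults :: "(nat \<Rightarrow> 'a::field mser) \<Rightarrow> nat \<Rightarrow> 'a mser \<Rightarrow> 'a mser" where
  "mults p 0 = id"
| "mults p (Suc m) = mpoly_mult (p m) \<circ> mults p m"

lemma msequi_mults:
  assumes "\<And>i. i < m \<Longrightarrow> supp_box n (d i) (p i)"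
  shows "msequi (mults p m)"
  using assms by (induction m) (auto intro!: msequi_id msequi_comp msequi_mpoly_mult)

lemma span_gens_mults:
  assumes "\<And>i. i < m \<Longrightarrow> supp_box n (d i) (p i)" "g \<in> mser.span (gens n b K f)"
  shows "mults p m g \<in> mser.span (gens n (b + (\<Sum>l<m. d l)) K f)"
  using assms(1)
proof (induction m)
  case 0
  thus ?case using assms(2) by simp
next
  case (Suc m)
  hence "mpoly_mult (p m) (mults p m g) \<in> mser.span (gens n (b + (\<Sum>l<m. d l) + d m) K f)"
    by (intro span_gens_mpoly_mult) auto
  thus ?case by (simp add: add.assoc)
qed

text \<open>The factors commute, so \<open>p i\<close> may act first and bring about the reduction;
  the others merely enlarge the box.\<close>

lemma span_gens_mults_factor:
  assumes "\<And>i. i < m \<Longrightarrow> supp_box n (d i) (p i)" "i < m"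
    and "mpoly_mult (p i) h \<in> mser.span (gens n (d i) K f)"
  shows "mults p m h \<in> mser.span (gens n (\<Sum>l<m. d l) K f)"
  using assms(1,2)
proof (induction m)
  case 0
  thus ?case by simp
next
  case (Suc m)
  show ?case
  proof (cases "i = m")
    case True
    have "mults p (Suc m) h = mults p m (mpoly_mult (p m) h)"
      using msequi_commute[of n "d m" "p m" "mults p m" h] msequi_mults[of m n d p] Suc.prems by simp
    moreover have "mults p m (mpoly_mult (p m) h) \<in> mser.span (gens n (d m + (\<Sum>l<m. d l)) K f)"
      using span_gens_mults[of m n d p "mpoly_mult (p m) h" "d m" K f] Suc.prems(1) assms(3) True by simp
    ultimately show ?thesis by (simp add: add.commute)
  next
    case False
    hence "mults p m h \<in> mser.span (gens n (\<Sum>l<m. d l) K f)"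
      using Suc.IH Suc.prems by simp
    hence "mpoly_mult (p m) (mults p m h) \<in> mser.span (gens n ((\<Sum>l<m. d l) + d m) K f)"
      using Suc.prems by (intro span_gens_mpoly_mult) auto
    thus ?thesis by simp
  qed
qed

lemma in_vars_mults:
  assumes "\<And>i. i < m \<Longrightarrow> supp_box n (d i) (p i)" "in_vars n g"
  shows "in_vars n (mults p m g)"
  using assms(1)
proof (induction m)
  case (Suc m)
  have "in_vars n (mpoly_mult (p m) (mults p m g))"
    using Suc by (intro in_vars_mpoly_mult[of n "d m"]) auto
  thus ?case by simp
qed (use assms(2) in simp)

lemma mults_cancel:
  assumes "\<And>i. i < m \<Longrightarrow> supp_box n (d i) (p i)" "\<And>i. i < m \<Longrightarrow> p i \<noteq> 0"
    and "in_vars n g" "mults p m g = 0"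
  shows "g = 0"
  using assms(1,2,4)
proof (induction m)
  case 0
  thus ?case by simp
next
  case (Suc m)
  have "in_vars n (mults p m g)"
    using Suc.prems(1) by (intro in_vars_mults[of m n d] assms(3)) simp
  moreover have "mpoly_mult (p m) (mults p m g) = 0"
    using Suc.prems(3) unfolding mults.simps o_apply .
  ultimately have "mults p m g = 0"
    using mpoly_mult_cancel[OF Suc.prems(1,2), of m] by blast
  thus ?case using Suc.IH Suc.prems(1,2) less_SucI by blast
qed

lemma mults_funpow_cancel:
  assumes "\<And>i. i < m \<Longrightarrow> supp_box n (d i) (p i)" "\<And>i. i < m \<Longrightarrow> p i \<noteq> 0"
    and "in_vars n g" "(mults p m ^^ q) g = 0"
  shows "g = 0"
  using assms(3,4)
proof (induction q arbitrary: g)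
  case 0
  thus ?case by simp
next
  case (Suc q)
  have "(mults p m ^^ q) (mults p m g) = 0"
    using Suc.prems(2) unfolding funpow.simps o_apply funpow_swap1 .
  moreover have "in_vars n (mults p m g)"
    using assms(1) Suc.prems(1) by (rule in_vars_mults)
  ultimately have "mults p m g = 0"
    using Suc.IH[of "mults p m g"] by (simp only: simp_thms)
  with assms(1,2) Suc.prems(1) show ?case by (rule mults_cancel)
qed

section \<open>Reduction of derivatives modulo the annihilating operators\<close>

locale annihilated =
  fixes n :: nat and f :: "'a::field_char_0 mser" and L :: "nat \<Rightarrow> nat \<Rightarrow> 'a mser" and r d :: "nat \<Rightarrow> nat"
  assumes supp: "\<And>i j. i < n \<Longrightarrow> j \<le> r i \<Longrightarrow> supp_box n (d i) (L i j)"
    and lead: "\<And>i. i < n \<Longrightarrow> L i (r i) \<noteq> 0"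
    and ann: "\<And>i. i < n \<Longrightarrow> (\<Sum>j\<le>r i. mpoly_mult (L i j) (mdd n ((\<lambda>_. 0)(i := j)) f)) = 0"
    and r_pos: "\<And>i. i < n \<Longrightarrow> 0 < r i"
    and vars: "in_vars n f"
begin

text \<open>The equation \<open>L_i(f) = 0\<close>, solved for its leading term, is differentiated
  until \<open>D^\<kappa>\<close> appears. Differentiation commutes with the leading coefficient up
  to terms of lower order, so a single factor suffices and exponents stay within
  \<open>d i\<close>.\<close>

lemma lead_mult_mdd_aux:
  assumes "i < n" "r i \<le> \<kappa> i" "(\<Sum>l<n. \<kappa> l) = r i + q" "\<forall>l\<ge>n. \<kappa> l = 0"
  shows "mpoly_mult (L i (r i)) (mdd n \<kappa> f) \<in> mser.span (gens n (d i) (ord_le n (r i + q - 1)) f)"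
  using assms(2-4)
proof (induction q arbitrary: \<kappa>)
  case 0
  have split: "(\<Sum>l<n. \<kappa> l) = \<kappa> i + (\<Sum>l\<in>{..<n}-{i}. \<kappa> l)"
    using assms(1) by (intro sum.remove) auto
  hence "\<kappa> i = r i" and "(\<Sum>l\<in>{..<n}-{i}. \<kappa> l) = 0"
    using 0 by linarith+
  hence "\<forall>l\<in>{..<n}-{i}. \<kappa> l = 0" by (simp only: sum_eq_0_iff finite_Diff finite_lessThan)
  hence \<kappa>: "\<kappa> = (\<lambda>_. 0)(i := r i)"
    using 0(3) \<open>\<kappa> i = r i\<close> by (metis DiffI ext fun_upd_apply lessThan_iff not_le singletonD)
  have "{..r i} = insert (r i) {..<r i}" by auto
  hence "mpoly_mult (L i (r i)) (mdd n \<kappa> f) =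
      - (\<Sum>j<r i. mpoly_mult (L i j) (mdd n ((\<lambda>_. 0)(i := j)) f))"
    using ann[OF assms(1)] by (simp add: \<kappa> eq_neg_iff_add_eq_0)
  also have "\<dots> \<in> mser.span (gens n (d i) (ord_le n (r i + 0 - 1)) f)"
  proof (intro mser.span_neg mser.span_sum)
    fix j assume j: "j \<in> {..<r i}"
    have "(\<Sum>l<n. ((\<lambda>_. 0)(i := j)) l) = j"
      using assms(1) by (subst sum.remove[of _ i]) auto
    hence "(\<lambda>_. 0)(i := j) \<in> ord_le n (r i + 0 - 1)"
      using j assms(1) by (auto simp: ord_le_def)
    hence "mpoly_mult (L i j) (mdd n ((\<lambda>_. 0)(i := j)) f)
        \<in> mser.span (gens n (0 + d i) (ord_le n (r i + 0 - 1)) f)"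
      using j by (intro span_gens_mpoly_mult mdd_in_span supp assms(1)) auto
    thus "mpoly_mult (L i j) (mdd n ((\<lambda>_. 0)(i := j)) f)
        \<in> mser.span (gens n (d i) (ord_le n (r i + 0 - 1)) f)" by simp
  qed
  finally show ?case .
next
  case (Suc q)
  have split: "(\<Sum>l<n. \<kappa> l) = \<kappa> i + (\<Sum>l\<in>{..<n}-{i}. \<kappa> l)"
    using assms(1) by (intro sum.remove) auto
  \<comment> \<open>A direction from which one derivative can be split off while
    \<open>r i \<le> \<kappa> i\<close> is kept: \<open>i\<close> itself if there is room, otherwise
    another non-zero component.\<close>
  have "\<exists>l<n. 0 < \<kappa> l \<and> r i \<le> (\<kappa>(l := \<kappa> l - 1)) i"
  proof (cases "r i < \<kappa> i")
    case True
    thus ?thesis using assms(1) by (intro exI[of _ i]) auto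
  next
    case False
    hence "(\<Sum>l\<in>{..<n}-{i}. \<kappa> l) \<noteq> 0" using Suc.prems split by simp
    then obtain l where "l \<in> {..<n}-{i}" "\<kappa> l \<noteq> 0" by (meson sum.neutral)
    thus ?thesis using Suc.prems by (intro exI[of _ l]) auto
  qed
  then obtain l where l: "l < n" "0 < \<kappa> l" "r i \<le> (\<kappa>(l := \<kappa> l - 1)) i" by blast
  define \<kappa>' where "\<kappa>' = \<kappa>(l := \<kappa> l - 1)"
  have \<kappa>: "\<kappa> = \<kappa>'(l := Suc (\<kappa>' l))" using l(2) by (auto simp: \<kappa>'_def)
  have "(\<Sum>k<n. \<kappa> k) = \<kappa> l + (\<Sum>k\<in>{..<n}-{l}. \<kappa> k)"
    using l(1) by (intro sum.remove) auto
  moreover have "(\<Sum>k<n. \<kappa>' k) = (\<kappa> l - 1) + (\<Sum>k\<in>{..<n}-{l}. \<kappa> k)"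
    using l(1) by (subst sum.remove[of _ l]) (auto simp: \<kappa>'_def)
  ultimately have sum': "(\<Sum>k<n. \<kappa>' k) = r i + q" using l(2) Suc.prems(2) by simp
  have supp': "\<forall>l\<ge>n. \<kappa>' l = 0" using Suc.prems(3) by (auto simp: \<kappa>'_def)
  let ?p = "L i (r i)" and ?S = "mser.span (gens n (d i) (ord_le n (r i + q)) f)"
  have "mderiv l (mpoly_mult ?p (mdd n \<kappa>' f)) \<in> mser.span (gens n (d i) (ord_le n (Suc (r i + q - 1))) f)"
    by (intro span_gens_mderiv l(1) Suc.IH sum' supp' l(3)[folded \<kappa>'_def])
  hence 1: "mderiv l (mpoly_mult ?p (mdd n \<kappa>' f)) \<in> ?S"
    using r_pos[OF assms(1)] by simp
  have "\<kappa>' \<in> ord_le n (r i + q)" using sum' supp' by (simp add: ord_le_def)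
  hence 2: "mderiv l (mpoly_mult ?p (mdd n \<kappa>' f)) - mpoly_mult ?p (mderiv l (mdd n \<kappa>' f)) \<in> ?S"
    using assms(1) by (intro mpoly_mult_mderiv_commutator supp) auto
  have "mpoly_mult ?p (mderiv l (mdd n \<kappa>' f)) \<in> ?S"
    using mser.span_diff[OF 1 2] by simp
  hence "mpoly_mult ?p (mdd n \<kappa> f) \<in> ?S"
    unfolding mderiv_mdd[OF l(1)] \<kappa>[symmetric] .
  thus ?case by simp
qed

lemma lead_mult_mdd:
  assumes "i < n" "r i \<le> \<kappa> i" "\<kappa> \<in> ord_le n (Suc q)"
  shows "mpoly_mult (L i (r i)) (mdd n \<kappa> f) \<in> mser.span (gens n (d i) (ord_le n q) f)"
proof -
  have "\<kappa> i \<le> (\<Sum>l<n. \<kappa> l)" using assms(1) by (intro member_le_sum) auto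
  hence "(\<Sum>l<n. \<kappa> l) = r i + ((\<Sum>l<n. \<kappa> l) - r i)" using assms(2) by simp
  hence "mpoly_mult (L i (r i)) (mdd n \<kappa> f)
      \<in> mser.span (gens n (d i) (ord_le n (r i + ((\<Sum>l<n. \<kappa> l) - r i) - 1)) f)"
    using assms by (intro lead_mult_mdd_aux) (auto simp: ord_le_def)
  thus ?thesis
    by (rule span_gens_mono) (use assms(2,3) \<open>\<kappa> i \<le> _\<close> in \<open>auto simp: ord_le_def\<close>)
qed

definition A :: "'a mser \<Rightarrow> 'a mser" where
  "A = mults (\<lambda>i. L i (r i)) n"

definition R :: "(nat \<Rightarrow> nat) set" where
  "R = {\<gamma>. (\<forall>l<n. \<gamma> l \<in> {..<r l}) \<and> (\<forall>l\<ge>n. \<gamma> l = 0)}"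

abbreviation \<delta> :: nat where "\<delta> \<equiv> \<Sum>l<n. d l"

lemma finite_R: "finite R" and card_R: "card R = (\<Prod>l<n. r l)"
  unfolding R_def by (rule card_fun_bounded, simp) (subst card_fun_bounded, simp_all)

lemma msequi_A_funpow: "msequi (A ^^ q)"
  unfolding A_def by (intro msequi_funpow msequi_mults[where d = d and n = n] supp) auto

lemma mlinear_A_funpow: "mlinear (A ^^ q)"
  and A_funpow_mshift: "(A ^^ q) (mshift \<beta> g) = mshift \<beta> ((A ^^ q) g)"
  using msequi_A_funpow by (auto simp: msequi_def)

text \<open>An application of \<open>A\<close> lowers the total order unless the derivative already
  lies in \<open>R\<close>, in which case it only adds \<open>\<delta>\<close> to the exponents.
  Hence \<open>q\<close> applications suffice for order \<open>q\<close>.\<close>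

lemma A_funpow_mdd:
  assumes "\<kappa> \<in> ord_le n q"
  shows "(A ^^ q) (mdd n \<kappa> f) \<in> mser.span (gens n (q * \<delta>) R f)"
  using assms
proof (induction q arbitrary: \<kappa>)
  case 0
  hence "\<kappa> \<in> R" using r_pos by (auto simp: ord_le_def R_def)
  thus ?case by (auto intro: mdd_in_span)
next
  case (Suc q)
  show ?case
  proof (cases "\<exists>i<n. r i \<le> \<kappa> i")
    case True
    then obtain i where i: "i < n" "r i \<le> \<kappa> i" by blast
    have "A (mdd n \<kappa> f) \<in> mser.span (gens n \<delta> (ord_le n q) f)"
      unfolding A_def
      by (intro span_gens_mults_factor[of n n d "\<lambda>i. L i (r i)" i] supp lead_mult_mdd Suc.prems i order_refl)
    hence "(A ^^ q) (A (mdd n \<kappa> f)) \<in> mser.span (gens n (q * \<delta> + \<delta>) R f)"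
    proof (rule mlinear_span[OF mlinear_A_funpow])
      fix x assume "x \<in> gens n \<delta> (ord_le n q) f"
      then obtain \<beta> \<kappa>' where x: "x = mshift \<beta> (mdd n \<kappa>' f)" "\<beta> \<in> box n \<delta>" "\<kappa>' \<in> ord_le n q"
        unfolding gens_def by blast
      show "(A ^^ q) x \<in> mser.span (gens n (q * \<delta> + \<delta>) R f)"
        unfolding x(1) A_funpow_mshift by (intro span_gens_mshift x(2) Suc.IH x(3))
    qed
    thus ?thesis by (simp add: funpow_swap1 add.commute)
  next
    case False
    hence "\<kappa> \<in> R" using Suc.prems by (auto simp: ord_le_def R_def)
    hence "mdd n \<kappa> f \<in> mser.span (gens n 0 R f)" by (rule mdd_in_span)
    hence "(A ^^ k) (mdd n \<kappa> f) \<in> mser.span (gens n (k * \<delta>) R f)" for k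
    proof (induction k)
      case (Suc k)
      have "A ((A ^^ k) (mdd n \<kappa> f)) \<in> mser.span (gens n (k * \<delta> + \<delta>) R f)"
        unfolding A_def[symmetric] using Suc
        by (subst A_def, intro span_gens_mults supp) auto
      thus ?case by (simp add: add.commute)
    qed simp
    thus ?thesis .
  qed
qed

lemma A_funpow_cancel: "in_vars n g \<Longrightarrow> (A ^^ q) g = 0 \<Longrightarrow> g = 0"
  unfolding A_def by (rule mults_funpow_cancel[of n n d]) (auto simp: supp lead)

end

section \<open>Operators acting coefficientwise\<close>

text \<open>A spanning set for the values at \<open>f\<close> of polynomials of degree at most
  \<open>q\<close> in the Euler operators \<open>x_l D_l\<close>, since the
  \<open>x^\<kappa> D^\<kappa>\<close> are their products of falling factorials.\<close>

definition thg :: "nat \<Rightarrow> nat \<Rightarrow> 'a::field mser \<Rightarrow> 'a mser set" where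
  "thg n q f = {mshift \<kappa> (mdd n \<kappa> f) | \<kappa>. \<kappa> \<in> ord_le n q}"

text \<open>Scaling each coefficient by \<open>\<alpha> l\<close> is the Euler operator
  \<open>x_l D_l\<close>, so this is the Leibniz rule for \<open>x^\<kappa> h\<close>, multiplied by
  \<open>x_l\<close>.\<close>

lemma theta_mshift:
  fixes h :: "'a::field mser"
  shows "(\<lambda>\<alpha>. of_nat (\<alpha> l) * mshift \<kappa> h \<alpha>) =
    mscale (of_nat (\<kappa> l)) (mshift \<kappa> h) + mshift (\<kappa>(l := Suc (\<kappa> l))) (mderiv l h)"
proof
  fix \<alpha>
  show "of_nat (\<alpha> l) * mshift \<kappa> h \<alpha> =
    (mscale (of_nat (\<kappa> l)) (mshift \<kappa> h) + mshift (\<kappa>(l := Suc (\<kappa> l))) (mderiv l h)) \<alpha>"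
  proof (cases "\<forall>k. \<kappa> k \<le> \<alpha> k")
    case True
    show ?thesis
    proof (cases "\<kappa> l = \<alpha> l")
      case eq: True
      hence "\<not> (\<kappa>(l := Suc (\<kappa> l))) l \<le> \<alpha> l" by simp
      hence no: "\<not> (\<forall>k. (\<kappa>(l := Suc (\<kappa> l))) k \<le> \<alpha> k)" by blast
      show ?thesis
        unfolding plus_fun_def mscale_def mshift_def if_P[OF True] if_not_P[OF no] by (simp add: eq)
    next
      case False
      hence lt: "\<kappa> l < \<alpha> l" using True le_neq_implies_less by blast
      have 1: "\<forall>k. (\<kappa>(l := Suc (\<kappa> l))) k \<le> \<alpha> k" using True lt by simp
      have 2: "(\<lambda>k. \<alpha> k - (\<kappa>(l := Suc (\<kappa> l))) k)(l := Suc (\<alpha> l - (\<kappa>(l := Suc (\<kappa> l))) l)) = (\<lambda>k. \<alpha> k - \<kappa> k)"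
        using lt by (auto simp: fun_eq_iff)
      have "Suc (\<alpha> l - (\<kappa>(l := Suc (\<kappa> l))) l) = \<alpha> l - \<kappa> l" using lt by simp
      hence 3: "of_nat (\<alpha> l) = (of_nat (\<kappa> l) + of_nat (Suc (\<alpha> l - (\<kappa>(l := Suc (\<kappa> l))) l)) :: 'a)"
        using lt by (metis less_imp_le_nat le_add_diff_inverse of_nat_add)
      show ?thesis
        unfolding plus_fun_def mscale_def mshift_def mderiv_def if_P[OF True] if_P[OF 1] 2 3
        by (simp only: distrib_right)
    qed
  next
    case False
    then obtain k where "\<not> \<kappa> k \<le> \<alpha> k" by blast
    hence "\<not> (\<kappa>(l := Suc (\<kappa> l))) k \<le> \<alpha> k" by (cases "k = l") auto
    hence no: "\<not> (\<forall>k. (\<kappa>(l := Suc (\<kappa> l))) k \<le> \<alpha> k)" by blast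
    show ?thesis
      unfolding plus_fun_def mscale_def mshift_def if_not_P[OF False] if_not_P[OF no] by simp
  qed
qed

lemma span_thg_theta:
  assumes "l < n" "g \<in> mser.span (thg n q f)"
  shows "(\<lambda>\<alpha>. of_nat (\<alpha> l) * g \<alpha>) \<in> mser.span (thg n (Suc q) f)"
proof -
  define T :: "'a mser \<Rightarrow> 'a mser" where "T = (\<lambda>g \<alpha>. of_nat (\<alpha> l) * g \<alpha>)"
  have "mlinear T" by (rule mlinearI) (simp_all add: T_def algebra_simps)
  hence "T g \<in> mser.span (thg n (Suc q) f)"
  proof (rule mlinear_span[OF _ assms(2)])
    fix x assume "x \<in> thg n q f"
    then obtain \<kappa> where x: "x = mshift \<kappa> (mdd n \<kappa> f)" "\<kappa> \<in> ord_le n q" unfolding thg_def by blast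
    have "\<kappa> \<in> ord_le n (Suc q)" using x(2) by (simp add: ord_le_def)
    hence "mshift \<kappa> (mdd n \<kappa> f) \<in> mser.span (thg n (Suc q) f)"
      unfolding thg_def by (intro mser.span_base) blast
    moreover have "mshift (\<kappa>(l := Suc (\<kappa> l))) (mdd n (\<kappa>(l := Suc (\<kappa> l))) f)
        \<in> mser.span (thg n (Suc q) f)"
      unfolding thg_def using ord_le_upd[OF x(2) assms(1)] by (intro mser.span_base) blast
    ultimately show "T x \<in> mser.span (thg n (Suc q) f)"
      unfolding T_def x(1) theta_mshift mderiv_mdd[OF assms(1)]
      by (intro mser.span_add mser.span_scale)
  qed
  thus ?thesis by (simp add: T_def)
qed

lemma span_thg_mono: "g \<in> mser.span (thg n q f) \<Longrightarrow> q \<le> q' \<Longrightarrow> g \<in> mser.span (thg n q' f)"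
  using mser.span_mono[of "thg n q f" "thg n q' f"] ord_le_mono[of q q' n] unfolding thg_def by blast

text \<open>With \<open>x\<^sub>l = s\<^sub>l\<close> for \<open>l < n - 1\<close> and \<open>x\<^bsub>n-1\<^esub> = t / (s\<^sub>0 \<cdots> s\<^bsub>n-2\<^esub>)\<close>, these are the exponents
  of \<open>s\<^sub>l\<close> and \<open>t\<close> in the image of \<open>x\<^sup>\<alpha>\<close> divided by \<open>s\<^sub>0 \<cdots> s\<^bsub>n-2\<^esub>\<close>.\<close>
definition lform :: "nat \<Rightarrow> nat \<Rightarrow> (nat \<Rightarrow> nat) \<Rightarrow> 'a::field" where
  "lform n l \<alpha> = (if l < n - 1 then of_nat (\<alpha> l) - of_nat (\<alpha> (n - 1)) - 1 else of_nat (\<alpha> (n - 1)))"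

text \<open>The scalar by which \<open>s\<^sup>k D\<^sub>s\<^sup>k t\<^sup>j D\<^sub>t\<^sup>j\<close> acts on that monomial, with \<open>\<kappa> = (k, j)\<close>.\<close>
definition weight :: "nat \<Rightarrow> (nat \<Rightarrow> nat) \<Rightarrow> (nat \<Rightarrow> nat) \<Rightarrow> 'a::field" where
  "weight n \<kappa> \<alpha> = (\<Prod>l<n. \<Prod>c<\<kappa> l. lform n l \<alpha> - of_nat c)"

lemma span_thg_lform:
  assumes "l < n" "g \<in> mser.span (thg n q f)"
  shows "(\<lambda>\<alpha>. (lform n l \<alpha> - c) * g \<alpha>) \<in> mser.span (thg n (Suc q) f)"
proof -
  \<comment> \<open>Absorbs the constant \<open>- 1\<close> that \<open>lform\<close> carries for
    \<open>l < n - 1\<close>.\<close>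
  define e where "e = (if l < n - 1 then c + 1 else c)"
  have n: "n - 1 < n" using assms(1) by simp
  have 0: "mscale e g \<in> mser.span (thg n (Suc q) f)"
    by (intro mser.span_scale span_thg_mono[OF assms(2)]) simp
  have "(\<lambda>\<alpha>. (lform n l \<alpha> - c) * g \<alpha>) =
    (if l < n - 1 then (\<lambda>\<alpha>. of_nat (\<alpha> l) * g \<alpha>) - (\<lambda>\<alpha>. of_nat (\<alpha> (n - 1)) * g \<alpha>)
      else (\<lambda>\<alpha>. of_nat (\<alpha> (n - 1)) * g \<alpha>)) - mscale e g"
    by (auto simp: fun_eq_iff lform_def e_def mscale_def algebra_simps)
  also have "\<dots> \<in> mser.span (thg n (Suc q) f)"
    using span_thg_theta[OF assms] span_thg_theta[OF n assms(2)] 0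
    by (simp add: mser.span_diff)
  finally show ?thesis .
qed

lemma span_thg_lform_prod:
  assumes "l < n" "g \<in> mser.span (thg n q f)"
  shows "(\<lambda>\<alpha>. (\<Prod>c<k. lform n l \<alpha> - of_nat c) * g \<alpha>) \<in> mser.span (thg n (q + k) f)"
proof (induction k)
  case 0
  thus ?case using assms(2) by simp
next
  case (Suc k)
  from span_thg_lform[OF assms(1) this, of "of_nat k"] show ?case
    by (simp add: mult_ac)
qed

lemma span_thg_weight:
  assumes "\<kappa> \<in> box n M"
  shows "(\<lambda>\<alpha>. weight n \<kappa> \<alpha> * f \<alpha>) \<in> mser.span (thg n (n * M) f)"
proof -
  have "(\<lambda>\<alpha>. (\<Prod>l<m. \<Prod>c<\<kappa> l. lform n l \<alpha> - of_nat c) * f \<alpha>) \<in> mser.span (thg n (\<Sum>l<m. \<kappa> l) f)"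
    if "m \<le> n" for m
    using that
  proof (induction m)
    case 0
    have "mshift (\<lambda>_. 0) (mdd n (\<lambda>_. 0) f) \<in> mser.span (thg n 0 f)"
      unfolding thg_def by (intro mser.span_base CollectI exI[of _ "\<lambda>_. 0"]) (simp add: ord_le_def)
    thus ?case by (simp add: mshift_zero mdd_zero)
  next
    case (Suc m)
    from span_thg_lform_prod[OF _ Suc.IH, of m "\<kappa> m"] Suc.prems show ?case
      by (simp add: mult_ac)
  qed
  from this[of n] have "(\<lambda>\<alpha>. weight n \<kappa> \<alpha> * f \<alpha>) \<in> mser.span (thg n (\<Sum>l<n. \<kappa> l) f)"
    by (simp add: weight_def)
  moreover have "(\<Sum>l<n. \<kappa> l) \<le> n * M"
    using sum_bounded_above[of "{..<n}" \<kappa> M] assms by (simp add: box_eq)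
  ultimately show ?thesis by (rule span_thg_mono)
qed

text \<open>The Laurent monomial \<open>t\<^sup>i s\<^bsup>-k\<^esup> t\<^bsup>-j\<^esup>\<close> in the variables \<open>x\<close>, multiplied by
  \<open>(x\<^sub>0 \<cdots> x\<^bsub>n-1\<^esub>)\<^bsup>2M\<^esup>\<close>; then no subtraction is truncated for \<open>\<kappa> \<in> box n M\<close>.\<close>
definition expo :: "nat \<Rightarrow> nat \<Rightarrow> nat \<Rightarrow> (nat \<Rightarrow> nat) \<Rightarrow> nat \<Rightarrow> nat" where
  "expo n M i \<kappa> l = (if l < n - 1 then 2 * M + i - \<kappa> l - \<kappa> (n - 1)
     else if l = n - 1 then 2 * M + i - \<kappa> (n - 1) else 0)"

text \<open>\<open>t^i D_t^j D_s^k\<close> is \<open>t^(i-j) s^(-k)\<close> times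
  \<open>s^k D_s^k t^j D_t^j\<close>: the latter scales coefficients by \<open>weight\<close>, the
  former is a monomial shift. The pair \<open>(k, j)\<close> is stored in \<open>\<kappa>\<close>,
  with \<open>j\<close> at index \<open>n - 1\<close>.\<close>

definition opmon :: "nat \<Rightarrow> nat \<Rightarrow> 'a::field mser \<Rightarrow> nat \<times> (nat \<Rightarrow> nat) \<Rightarrow> 'a mser" where
  "opmon n M f = (\<lambda>(i, \<kappa>). mshift (expo n M i \<kappa>) (\<lambda>\<alpha>. weight n \<kappa> \<alpha> * f \<alpha>))"

lemma expo_box: "0 < n \<Longrightarrow> i \<le> N \<Longrightarrow> expo n M i \<kappa> \<in> box n (2 * M + N)"
  by (auto simp: box_def expo_def)

lemma in_vars_opmon:
  assumes "0 < n" "in_vars n f"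
  shows "in_vars n (opmon n M f (i, \<kappa>))"
  unfolding opmon_def prod.case
  by (intro in_vars_mshift[OF expo_box[OF assms(1) order_refl]])
     (use assms(2) in \<open>auto simp: in_vars_def\<close>)

context annihilated
begin

lemma A_funpow_opmon:
  assumes "0 < n" "i \<le> N" "\<kappa> \<in> box n M"
  shows "(A ^^ (n * M)) (opmon n M f (i, \<kappa>)) \<in>
    mser.span (gens n (n * M * \<delta> + n * M + (2 * M + N)) R f)"
proof -
  let ?q = "n * M"
  have "(A ^^ ?q) (\<lambda>\<alpha>. weight n \<kappa> \<alpha> * f \<alpha>) \<in> mser.span (gens n (?q * \<delta> + ?q) R f)"
  proof (rule mlinear_span[OF mlinear_A_funpow span_thg_weight[OF assms(3)]])
    fix x assume "x \<in> thg n ?q f"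
    then obtain \<kappa>' where x: "x = mshift \<kappa>' (mdd n \<kappa>' f)" "\<kappa>' \<in> ord_le n ?q"
      unfolding thg_def by blast
    show "(A ^^ ?q) x \<in> mser.span (gens n (?q * \<delta> + ?q) R f)"
      unfolding x(1) A_funpow_mshift
      by (intro span_gens_mshift ord_le_box A_funpow_mdd x(2))
  qed
  thus ?thesis
    unfolding opmon_def prod.case A_funpow_mshift
    by (intro span_gens_mshift expo_box assms(1,2))
qed

text \<open>The relation is found among the images under \<open>A ^^ (n * M)\<close>, which lie in a
  small span. Multiplication by the leading coefficients is injective, so it holds for the series
  themselves.\<close>

lemma exists_opmon_relation:
  assumes "0 < n"
    and "Suc (n * M * \<delta> + n * M + (2 * M + N)) ^ n * (\<Prod>l<n. r l) < Suc N * Suc M ^ n"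
  shows "\<exists>c. (\<exists>x\<in>{..N} \<times> box n M. c x \<noteq> 0) \<and>
    (\<Sum>x\<in>{..N} \<times> box n M. mscale (c x) (opmon n M f x)) = 0"
proof -
  let ?I = "{..N} \<times> box n M" and ?B = "n * M * \<delta> + n * M + (2 * M + N)"
  have "card (gens n ?B R f) \<le> Suc ?B ^ n * (\<Prod>l<n. r l)"
    using card_gens[OF finite_R, of n ?B f] unfolding card_R .
  also have "\<dots> < card ?I"
    using assms(2) by (simp add: card_cartesian_product card_box)
  finally have card: "card (gens n ?B R f) < card ?I" .
  have "\<exists>c. (\<exists>x\<in>?I. c x \<noteq> 0) \<and>
      (\<Sum>x\<in>?I. mscale (c x) ((A ^^ (n * M)) (opmon n M f x))) = 0"
  proof (rule exists_linear_relation[OF _ finite_gens[OF finite_R] card])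
    show "finite ?I" by (simp add: finite_box)
    fix x assume "x \<in> ?I"
    thus "(A ^^ (n * M)) (opmon n M f x) \<in> mser.span (gens n ?B R f)"
      using A_funpow_opmon[OF assms(1)] by (cases x) auto
  qed
  then obtain c where c: "\<exists>x\<in>?I. c x \<noteq> 0"
    "(\<Sum>x\<in>?I. mscale (c x) ((A ^^ (n * M)) (opmon n M f x))) = 0" by blast
  have "in_vars n (\<Sum>x\<in>?I. mscale (c x) (opmon n M f x))"
    using in_vars_opmon[OF assms(1) vars] by (intro in_vars_sum) auto
  moreover have "(A ^^ (n * M)) (\<Sum>x\<in>?I. mscale (c x) (opmon n M f x)) = 0"
    using c(2) by (simp only: mser_pair.linear_sum[OF mlinear_A_funpow]
        mser_pair.linear_scale[OF mlinear_A_funpow])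
  ultimately have "(\<Sum>x\<in>?I. mscale (c x) (opmon n M f x)) = 0"
    by (rule A_funpow_cancel)
  with c(1) show ?thesis by blast
qed

end

section \<open>Passing to the diagonal\<close>

lemma fps_deriv_funpow_nth:
  fixes g :: "'a::field fps"
  shows "(fps_deriv ^^ j) g $ m = pochhammer (of_nat (Suc m)) j * g $ (m + j)"
proof (induction j arbitrary: m)
  case (Suc j)
  have "(fps_deriv ^^ Suc j) g $ m = of_nat (Suc m) * (pochhammer (of_nat (Suc m) + 1) j * g $ (m + Suc j))"
    using Suc[of "m + 1"] by (simp add: add.commute)
  thus ?case by (simp only: pochhammer_rec mult.assoc)
qed simp

lemma fps_of_poly_monom_mult_nth:
  fixes g :: "'a::field fps"
  shows "(fps_of_poly (monom a i) * g) $ \<tau> = (if i \<le> \<tau> then a * g $ (\<tau> - i) else 0)"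
proof -
  have "fps_of_poly (monom a i) * g = fps_const a * (fps_X ^ i * g)"
    unfolding fps_of_poly_monom mult.assoc ..
  thus ?thesis by (simp only: fps_mult_left_const_nth fps_X_power_mult_nth) simp
qed

text \<open>Matches the scalar by which \<open>t^j D_t^j\<close> acts on \<open>t^(m+j)\<close> with
  the factor in the coefficient of a \<open>j\<close>-fold derivative.\<close>

lemma prod_falling_eq_pochhammer:
  "(\<Prod>c<j. of_nat (m + j) - of_nat c) = (pochhammer (of_nat (Suc m)) j :: 'a::field)"
proof (induction j arbitrary: m)
  case (Suc j)
  have "(\<Prod>c<Suc j. of_nat (m + Suc j) - of_nat c) =
      of_nat (m + Suc j) * (\<Prod>c<j. of_nat (m + Suc j) - of_nat (Suc c) :: 'a)"
    by (subst prod.lessThan_Suc_shift) simp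
  also have "(\<Prod>c<j. of_nat (m + Suc j) - of_nat (Suc c)) = (\<Prod>c<j. of_nat (m + j) - of_nat c :: 'a)"
    by (intro prod.cong) auto
  also have "of_nat (m + Suc j) * \<dots> = (pochhammer (of_nat (Suc m)) (Suc j) :: 'a)"
    unfolding Suc by (simp add: pochhammer_rec' algebra_simps)
  finally show ?case .
qed simp

text \<open>The monomial \<open>s\<^bsup>-k\<^esup> t\<^sup>\<tau>\<close> in the variables \<open>x\<close>, again multiplied by \<open>(x\<^sub>0 \<cdots> x\<^bsub>n-1\<^esub>)\<^bsup>2M\<^esup>\<close>.
  It stands for \<open>s\<^bsup>-k-1\<^esup> t\<^sup>\<tau>\<close>, as the factor \<open>1 / (s\<^sub>0 \<cdots> s\<^bsub>n-2\<^esub>)\<close> is accounted for in \<open>lform\<close>.\<close>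
definition target :: "nat \<Rightarrow> nat \<Rightarrow> (nat \<Rightarrow> nat) \<Rightarrow> nat \<Rightarrow> nat \<Rightarrow> nat" where
  "target n M k \<tau> l = (if l < n - 1 then 2 * M + \<tau> - k l else if l = n - 1 then 2 * M + \<tau> else 0)"

text \<open>The \<open>\<kappa> l\<close>-th derivative could reach \<open>s_l^(-k l - 1)\<close>
  only from the power \<open>\<kappa> l - k l - 1\<close> of \<open>s_l\<close>. That power is
  non-negative and below \<open>\<kappa> l\<close>, so it is killed: a factor of the falling
  factorial is zero.\<close>

lemma opmon_target_eq_0:
  fixes f :: "'a::field mser"
  assumes "k \<in> box n M" "\<kappa> \<in> box n M" "l < n - 1" "k l < \<kappa> l"
  shows "opmon n M f (i, \<kappa>) (target n M k \<tau>) = 0"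
proof (cases "\<forall>l. expo n M i \<kappa> l \<le> target n M k \<tau> l")
  case True
  have n: "n - 1 < n" using assms(3) by simp
  have M: "k l \<le> M" "\<kappa> l \<le> M" "\<kappa> (n - 1) \<le> M"
    using assms n by (auto simp: box_eq)
  define \<alpha> where "\<alpha> = (\<lambda>l. target n M k \<tau> l - expo n M i \<kappa> l)"
  have "2 * M + i - \<kappa> (n - 1) \<le> 2 * M + \<tau>"
    using spec[OF True, of "n - 1"] by (simp add: expo_def target_def)
  hence "\<alpha> l = \<alpha> (n - 1) + \<kappa> l - k l"
    using M assms(3,4) by (simp add: \<alpha>_def expo_def target_def)
  hence "\<alpha> l = \<alpha> (n - 1) + 1 + (\<kappa> l - k l - 1)" using assms(4) by simp
  hence "lform n l \<alpha> - of_nat (\<kappa> l - k l - 1) = (0 :: 'a)"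
    using assms(3) by (simp add: lform_def)
  moreover have "\<kappa> l - k l - 1 \<in> {..<\<kappa> l}" using assms(4) by simp
  ultimately have "(\<Prod>c<\<kappa> l. lform n l \<alpha> - of_nat c) = (0 :: 'a)"
    by (intro prod_zero) auto
  hence "weight n \<kappa> \<alpha> = (0 :: 'a)"
    unfolding weight_def using assms(3) by (intro prod_zero) auto
  thus ?thesis by (simp add: opmon_def mshift_def \<alpha>_def)
qed (auto simp: opmon_def mshift_def)

text \<open>When the order in \<open>D_s\<close> is exactly \<open>k\<close>, the coefficient of
  \<open>s^(-k-1)\<close> comes from \<open>s^(-1)\<close> alone, that is, from diagonal exponents.
  \<open>D_s^k\<close> leaves a constant independent of \<open>i\<close>, \<open>j\<close> and
  \<open>\<tau>\<close>, and \<open>t^i D_t^j\<close> acts on the diagonal.\<close>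

lemma opmon_target:
  fixes f :: "'a::field mser"
  assumes "0 < n" "k \<in> box n M" "j \<le> M"
  shows "opmon n M f (i, k(n - 1 := j)) (target n M k \<tau>) =
    (\<Prod>l<n - 1. \<Prod>c<k l. - 1 - of_nat c) *
    (if i \<le> \<tau> then (fps_deriv ^^ j) (diagonal n f) $ (\<tau> - i) else 0)"
proof -
  define \<kappa> where "\<kappa> = k(n - 1 := j)"
  have \<kappa>: "\<kappa> l = k l" if "l < n - 1" for l using that by (simp add: \<kappa>_def)
  have \<kappa>j: "\<kappa> (n - 1) = j" "\<kappa> (n - Suc 0) = j" by (simp_all add: \<kappa>_def)
  have kM: "k l \<le> M" if "l < n - 1" for l using that assms(2) by (simp add: box_eq)
  show ?thesis
  proof (cases "i \<le> \<tau> + j")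
    case False
    hence "\<not> expo n M i \<kappa> (n - 1) \<le> target n M k \<tau> (n - 1)"
      using assms(3) by (simp add: expo_def target_def \<kappa>j)
    hence "opmon n M f (i, \<kappa>) (target n M k \<tau>) = 0"
      by (auto simp: opmon_def mshift_def)
    thus ?thesis using False by (simp add: \<kappa>_def)
  next
    case True
    define p where "p = \<tau> + j - i"
    define \<alpha> where "\<alpha> = (\<lambda>l. if l < n then p else 0)"
    have le: "\<forall>l. expo n M i \<kappa> l \<le> target n M k \<tau> l"
      using True by (auto simp: expo_def target_def \<kappa> \<kappa>j)
    have diff: "(\<lambda>l. target n M k \<tau> l - expo n M i \<kappa> l) = \<alpha>"
    proof
      fix l
      show "target n M k \<tau> l - expo n M i \<kappa> l = \<alpha> l"
        using True kM[of l] assms(1,3)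
        by (auto simp: expo_def target_def \<kappa> \<kappa>j \<alpha>_def p_def)
    qed
    have "{..<n} = insert (n - 1) {..<n - 1}" using assms(1) by auto
    hence "weight n \<kappa> \<alpha> = (\<Prod>c<j. lform n (n - 1) \<alpha> - of_nat c) *
        (\<Prod>l<n - 1. \<Prod>c<\<kappa> l. lform n l \<alpha> - of_nat c :: 'a)"
      by (simp add: weight_def \<kappa>j)
    also have "(\<Prod>l<n - 1. \<Prod>c<\<kappa> l. lform n l \<alpha> - of_nat c) = (\<Prod>l<n - 1. \<Prod>c<k l. - 1 - of_nat c :: 'a)"
      using assms(1) by (intro prod.cong) (auto simp: lform_def \<alpha>_def \<kappa>)
    also have "(\<Prod>c<j. lform n (n - 1) \<alpha> - of_nat c) = (\<Prod>c<j. of_nat p - of_nat c :: 'a)"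
      using assms(1) by (intro prod.cong) (auto simp: lform_def \<alpha>_def)
    finally have w: "weight n \<kappa> \<alpha> = (\<Prod>c<j. of_nat p - of_nat c) * (\<Prod>l<n - 1. \<Prod>c<k l. - 1 - of_nat c :: 'a)" .
    have "opmon n M f (i, \<kappa>) (target n M k \<tau>) = weight n \<kappa> \<alpha> * f \<alpha>"
      unfolding opmon_def prod.case mshift_def if_P[OF le] diff ..
    also have "\<dots> = (\<Prod>l<n - 1. \<Prod>c<k l. - 1 - of_nat c) * ((\<Prod>c<j. of_nat p - of_nat c) * diagonal n f $ p)"
      unfolding w by (simp add: diagonal_def \<alpha>_def)
    also have "(\<Prod>c<j. of_nat p - of_nat c) * diagonal n f $ p =
        (if i \<le> \<tau> then (fps_deriv ^^ j) (diagonal n f) $ (\<tau> - i) else 0)"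
    proof (cases "i \<le> \<tau>")
      case True
      hence "p = (\<tau> - i) + j" by (simp add: p_def)
      thus ?thesis using True
        by (simp only: prod_falling_eq_pochhammer fps_deriv_funpow_nth if_True)
    next
      case False
      \<comment> \<open>For \<open>\<tau> < i \<le> \<tau> + j\<close> the shift still reaches the
        exponent, but \<open>p < j\<close> puts a zero into the falling factorial.\<close>
      hence "p \<in> {..<j}" using \<open>i \<le> \<tau> + j\<close> by (auto simp: p_def)
      hence "(\<Prod>c<j. of_nat p - of_nat c) = (0 :: 'a)" by (intro prod_zero) auto
      thus ?thesis using False by simp
    qed
    finally show ?thesis unfolding \<kappa>_def .
  qed
qed

text \<open>Among the derivatives \<open>D\<^sub>s\<^sup>k\<close> occurring in the relation one of least total order survives alone
  in the coefficient of \<open>s\<^bsup>-k-1\<^esup>\<close>: any other one has a component exceeding that of \<open>k\<close>.\<close>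
lemma diagonal_operator_of_relation:
  fixes f :: "'a::field_char_0 mser"
  assumes n: "0 < n" and nz: "\<exists>x\<in>{..N} \<times> box n M. c x \<noteq> 0"
    and rel: "(\<Sum>x\<in>{..N} \<times> box n M. mscale (c x) (opmon n M f x)) = 0"
  shows "\<exists>P :: nat \<Rightarrow> 'a poly. \<exists>m\<le>M. P m \<noteq> 0 \<and> (\<forall>j>m. P j = 0) \<and> (\<forall>j. degree (P j) \<le> N) \<and>
    (\<Sum>j\<le>m. fps_of_poly (P j) * (fps_deriv ^^ j) (diagonal n f)) = 0"
proof -
  let ?I = "{..N} \<times> box n M"
  define size where "size = (\<lambda>\<kappa> :: nat \<Rightarrow> nat. \<Sum>l<n - 1. \<kappa> l)"
  obtain x0 where x0: "x0 \<in> ?I" "c x0 \<noteq> 0"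
    and min: "\<And>x. x \<in> ?I \<and> c x \<noteq> 0 \<Longrightarrow> size (snd x0) \<le> size (snd x)"
    using nz ex_has_least_nat[of "\<lambda>x. x \<in> ?I \<and> c x \<noteq> 0" _ "\<lambda>x. size (snd x)"] by blast
  define k where "k = snd x0"
  have k: "k \<in> box n M" using x0(1) by (auto simp: k_def)
  \<comment> \<open>Keeps the order \<open>k\<close> in \<open>D_s\<close> and lets the order in
    \<open>D_t\<close>, stored at index \<open>n - 1\<close>, vary.\<close>
  define upd where "upd = (\<lambda>j. k(n - 1 := j))"
  define P where "P = (\<lambda>j. if j \<le> M then \<Sum>i\<le>N. monom (c (i, upd j)) i else 0)"
  have coeff_P: "coeff (P j) i = (if j \<le> M \<and> i \<le> N then c (i, upd j) else 0)" for i j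
    by (auto simp: P_def coeff_sum sum.delta)
  have degree_P: "degree (P j) \<le> N" for j
    by (rule degree_le) (simp add: coeff_P)
  have "upd (k (n - 1)) = k" by (simp add: upd_def)
  hence "coeff (P (k (n - 1))) (fst x0) \<noteq> 0"
    using x0 k n by (auto simp: coeff_P k_def box_eq)
  hence ex: "P (k (n - 1)) \<noteq> 0" by auto
  define S where "S = {j. P j \<noteq> 0}"
  have S: "S \<subseteq> {..M}" by (auto simp: S_def P_def split: if_splits)
  hence fin: "finite S" using finite_subset by blast
  have ne: "S \<noteq> {}" using ex by (auto simp: S_def)
  define m where "m = Max S"
  have m: "m \<in> S" using Max_in[OF fin ne] by (simp add: m_def)
  have above: "P j = 0" if "m < j" for j
    using Max_ge[OF fin, of j] that by (auto simp: S_def m_def)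
  \<comment> \<open>The scalar produced by \<open>D_s^k\<close> on \<open>s^(-1)\<close>: up to sign
    the product of the factorials of the \<open>k l\<close>, hence non-zero in characteristic
    0.\<close>
  define K where "K = (\<Prod>l<n - 1. \<Prod>c<k l. - 1 - of_nat c :: 'a)"
  have "- 1 - of_nat c \<noteq> (0 :: 'a)" for c
  proof -
    have "- 1 - of_nat c = - (of_nat (Suc c) :: 'a)" by simp
    thus ?thesis by (simp only: neg_equal_0_iff_equal of_nat_eq_0_iff)
  qed
  hence K: "K \<noteq> 0" by (auto simp: K_def)
  have inj: "inj_on upd {..M}" by (auto simp: inj_on_def upd_def dest: fun_cong[where x = "n - 1"])
  have upd_box: "upd j \<in> box n M" if "j \<le> M" for j
    using k n that by (auto simp: box_eq upd_def)
  have "(\<Sum>j\<le>M. fps_of_poly (P j) * (fps_deriv ^^ j) (diagonal n f)) $ \<tau> = 0" for \<tau>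
  proof -
    let ?v = "\<lambda>i j. if i \<le> \<tau> then (fps_deriv ^^ j) (diagonal n f) $ (\<tau> - i) else 0"
    have vanish: "c (i, \<kappa>) * opmon n M f (i, \<kappa>) (target n M k \<tau>) = 0"
      if "i \<le> N" "\<kappa> \<in> box n M" "\<kappa> \<notin> upd ` {..M}" for i \<kappa>
    proof (cases "c (i, \<kappa>) = 0")
      case False
      hence ge: "size k \<le> size \<kappa>" using min[of "(i, \<kappa>)"] that by (simp add: k_def)
      \<comment> \<open>Otherwise minimality of the sum forces \<open>\<kappa>\<close> to agree with
        \<open>k\<close> away from \<open>n - 1\<close>, so that \<open>\<kappa>\<close> is one of
        the \<open>upd j\<close>.\<close>
      have "\<exists>l<n - 1. k l < \<kappa> l"
      proof (rule ccontr)
        assume no: "\<not> (\<exists>l<n - 1. k l < \<kappa> l)"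
        hence le: "\<forall>l\<in>{..<n - 1}. \<kappa> l \<le> k l" by (metis lessThan_iff not_le)
        have e1: "\<kappa> l = k l" if l: "l < n - 1" for l
        proof (rule ccontr)
          assume "\<kappa> l \<noteq> k l"
          with le l have "\<kappa> l < k l" by (metis lessThan_iff le_neq_implies_less)
          with l have "\<exists>l\<in>{..<n - 1}. \<kappa> l < k l" by blast
          with le have "size \<kappa> < size k"
            unfolding size_def by (intro sum_strict_mono_ex1 finite_lessThan)
          thus False using ge by simp
        qed
        have e2: "\<kappa> l = k l" if "l \<ge> n" for l using that k \<open>\<kappa> \<in> box n M\<close> by (simp add: box_eq)
        have "\<kappa> l = upd (\<kappa> (n - 1)) l" for l
        proof (cases "l = n - 1")
          case False
          hence "l < n - 1 \<or> l \<ge> n" by linarith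
          hence "\<kappa> l = k l" using e1 e2 by blast
          thus ?thesis using False by (simp add: upd_def)
        qed (simp add: upd_def)
        hence "\<kappa> = upd (\<kappa> (n - 1))" by blast
        moreover have "\<kappa> (n - 1) \<le> M" using \<open>\<kappa> \<in> box n M\<close> n by (simp add: box_eq)
        ultimately show False using that(3) by blast
      qed
      then obtain l where "l < n - 1" "k l < \<kappa> l" by blast
      hence "opmon n M f (i, \<kappa>) (target n M k \<tau>) = 0" by (rule opmon_target_eq_0[OF k that(2)])
      thus ?thesis by simp
    qed simp
    have "0 = (\<Sum>x\<in>?I. c x * opmon n M f x (target n M k \<tau>))"
      using fun_cong[OF rel, of "target n M k \<tau>"] by (simp add: sum_fun_apply mscale_def)
    also have "\<dots> = (\<Sum>i\<le>N. \<Sum>\<kappa>\<in>box n M. c (i, \<kappa>) * opmon n M f (i, \<kappa>) (target n M k \<tau>))"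
      by (simp add: sum.cartesian_product)
    also have "\<dots> = (\<Sum>i\<le>N. \<Sum>\<kappa>\<in>upd ` {..M}. c (i, \<kappa>) * opmon n M f (i, \<kappa>) (target n M k \<tau>))"
      using upd_box vanish by (intro sum.cong refl sum.mono_neutral_right finite_box) auto
    also have "\<dots> = (\<Sum>i\<le>N. \<Sum>j\<le>M. c (i, upd j) * (K * ?v i j))"
      unfolding sum.reindex[OF inj] o_def
      by (intro sum.cong refl) (simp only: upd_def opmon_target[OF n k] K_def atMost_iff)
    also have "\<dots> = K * (\<Sum>j\<le>M. \<Sum>i\<le>N. c (i, upd j) * ?v i j)"
      by (subst sum.swap) (simp only: sum_distrib_left mult.left_commute)
    also have "(\<Sum>j\<le>M. \<Sum>i\<le>N. c (i, upd j) * ?v i j) =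
        (\<Sum>j\<le>M. fps_of_poly (P j) * (fps_deriv ^^ j) (diagonal n f)) $ \<tau>"
      unfolding fps_sum_nth
    proof (intro sum.cong refl)
      fix j assume "j \<in> {..M}"
      hence "fps_of_poly (P j) = (\<Sum>i\<le>N. fps_of_poly (monom (c (i, upd j)) i))"
        by (simp add: P_def fps_of_poly_sum)
      thus "(\<Sum>i\<le>N. c (i, upd j) * ?v i j) = (fps_of_poly (P j) * (fps_deriv ^^ j) (diagonal n f)) $ \<tau>"
        by (simp only: sum_distrib_right fps_sum_nth fps_of_poly_monom_mult_nth)
           (intro sum.cong refl, simp)
    qed
    finally show ?thesis using K by simp
  qed
  hence "(\<Sum>j\<le>M. fps_of_poly (P j) * (fps_deriv ^^ j) (diagonal n f)) = 0"
    by (intro fps_ext) simp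
  also have "(\<Sum>j\<le>M. fps_of_poly (P j) * (fps_deriv ^^ j) (diagonal n f)) =
      (\<Sum>j\<le>m. fps_of_poly (P j) * (fps_deriv ^^ j) (diagonal n f))"
    using above m S by (intro sum.mono_neutral_right) auto
  finally have "(\<Sum>j\<le>m. fps_of_poly (P j) * (fps_deriv ^^ j) (diagonal n f)) = 0" .
  thus ?thesis using m S above degree_P by (intro exI[of _ P] exI[of _ m]) (auto simp: S_def)
qed

section \<open>The bounds\<close>

text \<open>Both sides are compared after multiplication by \<open>D ^ n\<close>, using
  \<open>D * (2 * N + 1) \<le> (2 * D + 1) * Suc N\<close> on the left and
  \<open>Suc N \<le> D * Suc M\<close> on the right. The choice of \<open>N\<close> turns the left
  side into at most \<open>N * Suc N ^ n\<close>, which is just below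
  \<open>Suc N * Suc N ^ n\<close>.\<close>

lemma dimension_count:
  fixes n \<delta> p D N M :: nat
  assumes "2 \<le> n" "0 < p" and D: "D = n * (2 + \<delta>)" and N: "N = (2 * D + 1) ^ n * p"
    and M: "M = N div D"
  shows "Suc (n * M * \<delta> + n * M + (2 * M + N)) ^ n * p < Suc N * Suc M ^ n"
proof -
  have D0: "0 < D" using assms(1) D by simp
  \<comment> \<open>Here \<open>n \<ge> 2\<close> enters, as
    \<open>2 * M \<le> n * M\<close>.\<close>
  have "n * M * \<delta> + n * M + 2 * M \<le> n * M * \<delta> + n * M + n * M"
    using assms(1) by simp
  also have "\<dots> = M * D" by (simp add: D algebra_simps)
  also have "\<dots> \<le> N" by (simp add: M)
  finally have "Suc (n * M * \<delta> + n * M + (2 * M + N)) \<le> 2 * N + 1" by simp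
  hence "D * Suc (n * M * \<delta> + n * M + (2 * M + N)) \<le> D * (2 * N + 1)" by (intro mult_left_mono) auto
  also have "\<dots> \<le> (2 * D + 1) * Suc N" by (simp add: algebra_simps)
  finally have "(D * Suc (n * M * \<delta> + n * M + (2 * M + N))) ^ n * p \<le> ((2 * D + 1) * Suc N) ^ n * p"
    by (intro mult_right_mono power_mono) auto
  also have "\<dots> = (2 * D + 1) ^ n * p * Suc N ^ n" by (simp only: power_mult_distrib mult_ac)
  also have "\<dots> = N * Suc N ^ n" by (simp only: N[symmetric])
  also have "\<dots> < Suc N * Suc N ^ n" by simp
  also have "\<dots> \<le> Suc N * (D * Suc M) ^ n"
  proof (intro mult_left_mono power_mono)
    show "Suc N \<le> D * Suc M" using dividend_less_times_div[OF D0, of N] by (simp add: M Suc_le_eq)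
  qed auto
  finally have "D ^ n * (Suc (n * M * \<delta> + n * M + (2 * M + N)) ^ n * p) < D ^ n * (Suc N * Suc M ^ n)"
    by (simp only: power_mult_distrib mult_ac)
  thus ?thesis by simp
qed


text \<open>\<open>2 * D + 1\<close> exceeds \<open>2 n^2 x\<close> at most by the factor
  \<open>1 + (5 / 2) / n\<close>, whose \<open>n\<close>-th power stays below
  \<open>exp (5 / 2)\<close>. The 5 consists of 4 from \<open>2 * (n * 2)\<close> and 1 from
  bounding the summand 1 by \<open>n\<close>.\<close>

lemma power_bound:
  fixes D x :: real and n m :: nat
  assumes "1 \<le> n" "1 \<le> x" "0 \<le> D" "D \<le> n * (2 + n * x)" "m \<le> n"
  shows "(2 * D + 1) ^ m \<le> exp (5 / 2) * (2 * real n ^ 2 * x) ^ m"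
proof -
  have n: "1 \<le> real n" using assms(1) by simp
  have "2 * D + 1 \<le> 2 * (n * (2 + n * x)) + n" using assms(4) n by linarith
  also have "\<dots> = 2 * real n ^ 2 * x + 5 * n" by (simp add: power2_eq_square algebra_simps)
  also have "\<dots> \<le> 2 * real n ^ 2 * x + 5 * (n * x)"
    using mult_left_mono[OF assms(2), of "real n"] by simp
  also have "\<dots> = 2 * real n ^ 2 * x * (1 + (5 / 2) / n)"
    using n by (simp add: field_simps power2_eq_square)
  finally have "(2 * D + 1) ^ m \<le> (2 * real n ^ 2 * x * (1 + (5 / 2) / n)) ^ m"
    using assms(3) by (intro power_mono) auto
  also have "\<dots> = (1 + (5 / 2) / n) ^ m * (2 * real n ^ 2 * x) ^ m"
    by (simp only: power_mult_distrib mult.commute)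
  also have "\<dots> \<le> exp (5 / 2) * (2 * real n ^ 2 * x) ^ m"
  proof (rule mult_right_mono)
    have "(1 + (5 / 2) / real n) ^ m \<le> (1 + (5 / 2) / real n) ^ n"
      using assms(5) by (intro power_increasing) auto
    also have "\<dots> \<le> exp (5 / 2)"
      using assms(1) by (intro exp_ge_one_plus_x_over_n_power_n) auto
    finally show "(1 + (5 / 2) / real n) ^ m \<le> exp (5 / 2)" .
  qed (use assms(2) in simp)
  finally show ?thesis .
qed

lemma Dval_bounds:
  assumes "1 \<le> n"
  shows "2 \<le> Dval n d" "real (Dval n d) \<le> n * (2 + n * real (maxof n d))"
proof -
  have "n * 2 \<le> Dval n d" by (simp add: Dval_def)
  thus "2 \<le> Dval n d" using assms by linarith
  have "(\<Sum>i<n. d i) \<le> n * maxof n d"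
    using sum_bounded_above[of "{..<n}" d "maxof n d"] by (simp add: maxof_def)
  hence "Dval n d \<le> n * (2 + n * maxof n d)" by (simp add: Dval_def)
  hence "real (Dval n d) \<le> real (n * (2 + n * maxof n d))" by (simp only: of_nat_le_iff)
  thus "real (Dval n d) \<le> n * (2 + n * real (maxof n d))"
    by (simp only: of_nat_mult of_nat_add of_nat_numeral)
qed

lemma prod_le_maxof: "real (\<Prod>j<n. r j) \<le> real (maxof n r) ^ n"
proof -
  have "(\<Prod>j<n. r j) \<le> (\<Prod>j<n. maxof n r)"
    by (intro prod_mono) (auto simp: maxof_def)
  hence "(\<Prod>j<n. r j) \<le> maxof n r ^ n" by simp
  thus ?thesis unfolding of_nat_power[symmetric] of_nat_le_iff .
qed

text \<open>For \<open>Nbound\<close> one factor \<open>2 * D + 1\<close> is spent on the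
  denominator through \<open>2 * D + 1 \<le> 3 * D\<close>, which leaves the exponent
  \<open>n - 1\<close>. The first estimate carries the same 3 so that both share one
  constant.\<close>

lemma bounds_asymptotic:
  fixes \<epsilon> :: real
  assumes "0 < \<epsilon>" "1 \<le> n" "1 \<le> maxof n d"
  shows "real (Nprime n d r) \<le> 3 * exp (5 / 2) * (2 + \<epsilon>) ^ n * real n ^ (2 * n)
           * real (maxof n d) ^ n * real (maxof n r) ^ n" (is ?A)
    and "Nbound n d r \<le> 3 * exp (5 / 2) * (2 + \<epsilon>) ^ n * real n ^ (2 * n - 1)
           * real (maxof n d) ^ (n - 1) * real (maxof n r) ^ n" (is ?B)
proof -
  define D x p R where "D = real (Dval n d)" and "x = real (maxof n d)"
    and "p = real (\<Prod>j<n. r j)" and "R = real (maxof n r)"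
  have D: "2 \<le> D" "D \<le> n * (2 + n * x)"
    using Dval_bounds[OF assms(2), of d] by (simp_all add: D_def x_def)
  have x: "1 \<le> x" using assms(3) by (simp add: x_def)
  have n: "1 \<le> real n" using assms(2) by simp
  have p: "0 \<le> p" "p \<le> R ^ n" using prod_le_maxof[of r n] by (simp_all add: p_def R_def prod_nonneg)
  have pow: "(2 * D + 1) ^ m \<le> exp (5 / 2) * ((2 + \<epsilon>) ^ n * real n ^ (2 * m) * x ^ m)" if "m \<le> n" for m
  proof -
    have "(2 * D + 1) ^ m \<le> exp (5 / 2) * (2 * real n ^ 2 * x) ^ m"
      using D by (intro power_bound assms(2) x that) auto
    also have "(2 * real n ^ 2 * x) ^ m = 2 ^ m * (real n ^ (2 * m) * x ^ m)"
      by (simp only: power_mult_distrib power_mult mult.assoc)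
    also have "exp (5 / 2) * \<dots> \<le> exp (5 / 2) * ((2 + \<epsilon>) ^ n * (real n ^ (2 * m) * x ^ m))"
    proof (intro mult_left_mono mult_right_mono)
      have "2 ^ m \<le> (2 + \<epsilon>) ^ m" using assms(1) by (intro power_mono) auto
      also have "\<dots> \<le> (2 + \<epsilon>) ^ n" using assms(1) that by (intro power_increasing) auto
      finally show "2 ^ m \<le> (2 + \<epsilon>) ^ n" .
    qed (use x in auto)
    finally show ?thesis by (simp only: mult.assoc)
  qed
  have "real (Nprime n d r) = (2 * D + 1) ^ n * p"
    by (simp only: Nprime_def D_def p_def of_nat_mult of_nat_power of_nat_add of_nat_numeral of_nat_1)
  also have "\<dots> \<le> (exp (5 / 2) * ((2 + \<epsilon>) ^ n * real n ^ (2 * n) * x ^ n)) * R ^ n"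
    using p x assms(1) by (intro mult_mono pow) auto
  also have "\<dots> \<le> 3 * \<dots>"
    using x assms(1) by (simp add: R_def)
  finally show ?A by (simp only: x_def R_def mult_ac)
  have "Nbound n d r = (2 * D + 1) ^ n * p / D"
    by (simp only: Nbound_def D_def p_def of_nat_mult of_nat_power of_nat_add of_nat_numeral of_nat_1)
  also have "(2 * D + 1) ^ n = (2 * D + 1) ^ (n - 1) * (2 * D + 1)"
    using assms(2) by (intro power_minus_mult[symmetric]) simp
  also have "(2 * D + 1) ^ (n - 1) * (2 * D + 1) * p / D = (2 * D + 1) ^ (n - 1) * p * ((2 * D + 1) / D)"
    by simp
  also have "\<dots> \<le> (2 * D + 1) ^ (n - 1) * p * 3"
    using D p by (intro mult_left_mono) (auto simp: field_simps)
  also have "\<dots> \<le> (exp (5 / 2) * ((2 + \<epsilon>) ^ n * real n ^ (2 * n - 1) * x ^ (n - 1))) * R ^ n * 3"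
  proof (intro mult_right_mono mult_mono p)
    have "(2 * D + 1) ^ (n - 1) \<le> exp (5 / 2) * ((2 + \<epsilon>) ^ n * real n ^ (2 * (n - 1)) * x ^ (n - 1))"
      by (rule pow) simp
    also have "\<dots> \<le> exp (5 / 2) * ((2 + \<epsilon>) ^ n * real n ^ (2 * n - 1) * x ^ (n - 1))"
      using n x assms(1) by (intro mult_left_mono mult_right_mono power_increasing) auto
    finally show "(2 * D + 1) ^ (n - 1) \<le> exp (5 / 2) * ((2 + \<epsilon>) ^ n * real n ^ (2 * n - 1) * x ^ (n - 1))" .
  qed (use x assms(1) in auto)
  finally show ?B by (simp only: x_def R_def mult_ac)
qed

section \<open>From the annihilating operators to the operator for the diagonal\<close>

lemma supp_box_of_mop:
  assumes "is_mop n L r" "j \<le> r"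
  shows "supp_box n (mop_deg n r L) (L j)"
  unfolding supp_box_def box_eq
proof (intro allI impI CollectI conjI)
  fix \<beta> assume \<beta>: "L j \<beta> \<noteq> 0"
  have fin: "finite {\<alpha>. L j \<alpha> \<noteq> 0}" and vars: "in_vars n (L j)"
    using assms(1) by (auto simp: is_mop_def is_mpoly_def)
  show "\<beta> l = 0" if "n \<le> l" for l using vars \<beta> that by (simp add: in_vars_def)
  have "{(\<Sum>k<n. \<alpha> k) | \<alpha>. L j \<alpha> \<noteq> 0} = (\<lambda>\<alpha>. \<Sum>k<n. \<alpha> k) ` {\<alpha>. L j \<alpha> \<noteq> 0}" by blast
  hence "(\<Sum>k<n. \<beta> k) \<le> mpoly_tdeg n (L j)"
    unfolding mpoly_tdeg_def using fin \<beta> by (intro Max_ge) auto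
  also have "\<dots> \<le> mop_deg n r L"
    unfolding mop_deg_def using assms(2) by (intro Max_ge) auto
  finally have le: "(\<Sum>k<n. \<beta> k) \<le> mop_deg n r L" .
  fix l assume "l < n"
  hence "\<beta> l \<le> (\<Sum>k<n. \<beta> k)" by (intro member_le_sum) auto
  thus "\<beta> l \<in> {..mop_deg n r L}" using le by simp
qed

lemma exists_diagonal_operator:
  fixes f :: "'a::field_char_0 mser"
  assumes "n \<ge> 2" "in_vars n f"
    and mop: "\<forall>i<n. is_mop n (L i) (r i)"
    and L0: "\<forall>i<n. diffop_apply i (r i) (L i) f = (\<lambda>_. 0)"
    and d: "\<forall>i<n. d i = mop_deg n (r i) (L i)"
  shows "\<exists>P :: nat \<Rightarrow> 'a poly. \<exists>m\<le>Nprime n d r div Dval n d. P m \<noteq> 0 \<and> (\<forall>j>m. P j = 0) \<and>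
    (\<forall>j. degree (P j) \<le> Nprime n d r) \<and>
    (\<Sum>j\<le>m. fps_of_poly (P j) * (fps_deriv ^^ j) (diagonal n f)) = 0"
proof (cases "\<exists>i<n. r i = 0")
  case True
  then obtain i where i: "i < n" "r i = 0" by blast
  \<comment> \<open>An operator of order 0 is multiplication by a non-zero polynomial, so
    \<open>f = 0\<close> and the operator 1 annihilates the diagonal. The product of the
    \<open>r j\<close> is 0 here, so both bounds are 0 and are met.\<close>
  have "mpoly_mult (L i 0) f = 0"
    using L0 i by (auto simp: diffop_apply_def fun_eq_iff)
  moreover have "supp_box n (mop_deg n (r i) (L i)) (L i 0)"
    using mop i by (intro supp_box_of_mop) auto
  moreover have "L i 0 \<noteq> 0"
    using mop i by (auto simp: is_mop_def zero_fun_def)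
  ultimately have "f = 0" using mpoly_mult_cancel[OF _ _ assms(2)] by blast
  hence "diagonal n f = 0" by (simp add: diagonal_def fps_eq_iff)
  thus ?thesis
    by (intro exI[of _ "\<lambda>j. if j = 0 then 1 else 0"] exI[of _ 0]) simp
next
  case False
  interpret annihilated n f L r d
  proof
    fix i assume i: "i < n"
    show "supp_box n (d i) (L i j)" if "j \<le> r i" for j
      using mop d i that by (simp add: supp_box_of_mop)
    show "L i (r i) \<noteq> 0" using mop i by (simp add: is_mop_def zero_fun_def)
    show "0 < r i" using False i by auto
    have "(\<Sum>j\<le>r i. mpoly_mult (L i j) (mdd n ((\<lambda>_. 0)(i := j)) f)) = diffop_apply i (r i) (L i) f"
      unfolding diffop_apply_def mderiv_funpow_mdd[OF i] by (rule ext) (rule sum_fun_apply)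
    thus "(\<Sum>j\<le>r i. mpoly_mult (L i j) (mdd n ((\<lambda>_. 0)(i := j)) f)) = 0"
      using L0 i by (simp add: zero_fun_def)
  qed (fact assms(2))
  have n: "0 < n" using assms(1) by simp
  have "0 < (\<Prod>l<n. r l)" using r_pos by (intro prod_pos) auto
  from exists_opmon_relation[OF n dimension_count[OF assms(1) this Dval_def Nprime_def refl]]
  show ?thesis using diagonal_operator_of_relation[OF n] by blast
qed

theorem theorem4p12:
  fixes f :: "'a::field_char_0 mser" and n :: nat
    and L :: "nat \<Rightarrow> nat \<Rightarrow> 'a mser" and r d :: "nat \<Rightarrow> nat"
  assumes "n \<ge> 2"
    and "in_vars n f"
    and "D_finite n f"
    and "\<forall>i<n. is_mop n (L i) (r i)"
    and "\<forall>i<n. diffop_apply i (r i) (L i) f = (\<lambda>_. 0)"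
    and "\<forall>i<n. d i = mop_deg n (r i) (L i)"
  shows "(\<exists>P :: nat \<Rightarrow> 'a poly. \<exists>ordP. P ordP \<noteq> 0 \<and> (\<forall>j>ordP. P j = 0) \<and>
            (\<Sum>j\<le>ordP. fps_of_poly (P j) * (fps_deriv ^^ j) (diagonal n f)) = 0 \<and>
            (\<forall>j. degree (P j) \<le> Nprime n d r) \<and> real ordP \<le> Nbound n d r)
       \<and> (\<forall>\<epsilon>::real>0. \<exists>C::real. \<exists>M::nat. \<forall>n' d' r'.
            n' \<ge> M \<and> maxof n' d' \<ge> M \<and> maxof n' r' \<ge> M \<longrightarrow>
              real (Nprime n' d' r') \<le> C * (2 + \<epsilon>) ^ n' * real n' ^ (2 * n')
                 * real (maxof n' d') ^ n' * real (maxof n' r') ^ n'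
            \<and> Nbound n' d' r' \<le> C * (2 + \<epsilon>) ^ n' * real n' ^ (2 * n' - 1)
                 * real (maxof n' d') ^ (n' - 1) * real (maxof n' r') ^ n')"
proof (intro conjI allI impI)
  obtain P :: "nat \<Rightarrow> 'a poly" and m where P: "m \<le> Nprime n d r div Dval n d" "P m \<noteq> 0"
    "\<forall>j>m. P j = 0" "\<forall>j. degree (P j) \<le> Nprime n d r"
    "(\<Sum>j\<le>m. fps_of_poly (P j) * (fps_deriv ^^ j) (diagonal n f)) = 0"
    using exists_diagonal_operator[OF assms(1,2,4-6)] by blast
  have "real m \<le> real (Nprime n d r div Dval n d)" using P(1) by simp
  also have "\<dots> \<le> Nbound n d r"
    unfolding Nbound_def Nprime_def[symmetric] by (rule of_nat_div_le_of_nat)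
  finally show "\<exists>P :: nat \<Rightarrow> 'a poly. \<exists>ordP. P ordP \<noteq> 0 \<and> (\<forall>j>ordP. P j = 0) \<and>
      (\<Sum>j\<le>ordP. fps_of_poly (P j) * (fps_deriv ^^ j) (diagonal n f)) = 0 \<and>
      (\<forall>j. degree (P j) \<le> Nprime n d r) \<and> real ordP \<le> Nbound n d r"
    using P(2-5) by blast
next
  fix \<epsilon> :: real assume "0 < \<epsilon>"
  thus "\<exists>C::real. \<exists>M::nat. \<forall>n' d' r'.
            n' \<ge> M \<and> maxof n' d' \<ge> M \<and> maxof n' r' \<ge> M \<longrightarrow>
              real (Nprime n' d' r') \<le> C * (2 + \<epsilon>) ^ n' * real n' ^ (2 * n')
                 * real (maxof n' d') ^ n' * real (maxof n' r') ^ n'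
            \<and> Nbound n' d' r' \<le> C * (2 + \<epsilon>) ^ n' * real n' ^ (2 * n' - 1)
                 * real (maxof n' d') ^ (n' - 1) * real (maxof n' r') ^ n'"
    \<comment> \<open>One constant serves every \<open>\<epsilon>\<close>; the threshold 1 supplies
      the lower bounds on \<open>n'\<close> and \<open>maxof n' d'\<close>.\<close>
    using bounds_asymptotic by (intro exI[of _ "3 * exp (5 / 2)"] exI[of _ 1]) blast
qed

end
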